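(* Let $n\ge2$ be an integer. For every $\pi\in S_n$, $$\mathrm{Wg}_{n,n}(\pi)=\sum_{\tau\in S_{n-1}}a_n(\pi,\tau)\,\mathrm{Wg}_{n-1,n-1}(\tau),$$ where the function $a_n\colon S_n\times S_{n-1}\to\mathbb{C}$ is defined by $$a_n(\pi,\tau)=\sum_{t=0}^{\mathsf{f}(\pi,\tau)}(-1)^{n-t+1}\binom{\mathsf{f}(\pi,\tau)}{t}\frac{1}{n^{\uparrow(n-t)}},\qquad \mathsf{f}(\pi,\tau)=|\{i\in\{1,2,\dots,n-1\}:\pi(\tau(i))=i\}|.$$
   Context: Rising factorial: $a^{\uparrow k}=\prod_{j=0}^{k-1}(a+j)$ for $k\ge1$, and $a^{\uparrow 0}=1$. Weingarten function: for positive integers $k\le n$ and $\pi\in S_k$ (the symmetric group on $\{1,\dots,k\}$), $$\mathrm{Wg}_{k,n}(\pi)=\mathbb{E}\bigl[u_{11}u_{22}\cdots u_{kk}\,\overline{u_{1\pi(1)}u_{2\pi(2)}\cdots u_{k\pi(k)}}\bigr],$$ where $U=(u_{ij})$ is a Haar-distributed matrix in the unitary group $\mathrm{U}(n)$. (It is a class function on $S_k$; equivalently, it is the convolution inverse in the group algebra $\mathbb{C}[S_k]$, with product $(f_1*f_2)(\pi)=\sum_{\sigma\in S_k}f_1(\sigma)f_2(\sigma^{-1}\pi)$, of the function $\pi\mapsto n^{\kappa(\pi)}$, where $\kappa(\pi)$ is the number of cycles of $\pi$, including fixed points.) *)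

theory Defs
  imports "HOL-Probability.Probability" "Jordan_Normal_Form.Schur_Decomposition"
begin

definition unitary_group :: "nat \<Rightarrow> complex mat set" where
  "unitary_group n = {A \<in> carrier_mat n n. A * mat_adjoint A = 1\<^sub>m n \<and> mat_adjoint A * A = 1\<^sub>m n}"

text \<open>The Borel \<open>\<sigma>\<close>-algebra of \<open>U(n)\<close>: the trace of the Borel \<open>\<sigma>\<close>-algebra of the space of
  complex \<open>n \<times> n\<close> arrays, pulled back along the map sending a matrix to its array of entries.\<close>

definition borel_unitary :: "nat \<Rightarrow> complex mat measure" where
  "borel_unitary n =
     vimage_algebra (unitary_group n) (\<lambda>A. \<lambda>(i, j)\<in>{..<n} \<times> {..<n}. A $$ (i, j))
       (PiM ({..<n} \<times> {..<n}) (\<lambda>_. borel))"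

text \<open>Existence and uniqueness of Haar measure are not available in the libraries, so Haar measure
  is a predicate: \<open>haar_unitary n \<mu>\<close> says that \<open>\<mu>\<close> is the law of a Haar-distributed matrix
  in \<open>U(n)\<close>. Left invariance suffices, since \<open>U(n)\<close> is compact.\<close>

definition haar_unitary :: "nat \<Rightarrow> complex mat measure \<Rightarrow> bool" where
  "haar_unitary n \<mu> \<longleftrightarrow> prob_space \<mu> \<and> sets \<mu> = sets (borel_unitary n) \<and>
     (\<forall>V\<in>unitary_group n. distr \<mu> \<mu> (\<lambda>A. V * A) = \<mu>)"

text \<open>\<open>Wg \<mu> k \<pi>\<close> is \<open>Wg\<^sub>k\<^sub>,\<^sub>n(\<pi>)\<close> when \<open>haar_unitary n \<mu>\<close> and \<open>k \<le> n\<close>. Permutations act on \<open>{1..k}\<close>,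
  whereas matrix indices start at 0, so \<open>u\<^sub>i\<^sub>j\<close> is \<open>U $$ (i - 1, j - 1)\<close>.\<close>

definition Wg :: "complex mat measure \<Rightarrow> nat \<Rightarrow> (nat \<Rightarrow> nat) \<Rightarrow> complex" where
  "Wg \<mu> k \<pi> = (\<integral>U. (\<Prod>i=1..k. U $$ (i - 1, i - 1)) *
                     cnj (\<Prod>i=1..k. U $$ (i - 1, \<pi> i - 1)) \<partial>\<mu>)"

definition fix_count :: "nat \<Rightarrow> (nat \<Rightarrow> nat) \<Rightarrow> (nat \<Rightarrow> nat) \<Rightarrow> nat" where
  "fix_count n \<pi> \<tau> = card {i \<in> {1..n - 1}. \<pi> (\<tau> i) = i}"

definition wg_coeff :: "nat \<Rightarrow> (nat \<Rightarrow> nat) \<Rightarrow> (nat \<Rightarrow> nat) \<Rightarrow> complex" where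
  "wg_coeff n \<pi> \<tau> =
     (\<Sum>t=0..fix_count n \<pi> \<tau>. (-1) ^ (n - t + 1) * of_nat (fix_count n \<pi> \<tau> choose t) *
        (1 / pochhammer (of_nat n) (n - t)))"

text \<open>Left translations are measurable and integrands of \<open>Wg\<close> are integrable, so that neither
  \<open>distr\<close> above nor the Bochner integral takes a default value.\<close>

lemma space_borel_unitary [simp]: "space (borel_unitary n) = unitary_group n"
  by (simp add: borel_unitary_def)

lemma measurable_unitary_entry:
  assumes "i < n" "j < n"
  shows "(\<lambda>A. A $$ (i, j)) \<in> borel_measurable (borel_unitary n)"
proof -
  let ?f = "\<lambda>A::complex mat. \<lambda>(i, j)\<in>{..<n} \<times> {..<n}. A $$ (i, j)"
  have "?f \<in> borel_unitary n \<rightarrow>\<^sub>M PiM ({..<n} \<times> {..<n}) (\<lambda>_. borel)"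
    unfolding borel_unitary_def
    by (rule measurable_vimage_algebra1) (auto simp: space_PiM)
  from measurable_compose[OF this measurable_component_singleton[of "(i, j)"]]
  show ?thesis using assms by simp
qed

lemma measurable_into_borel_unitary:
  assumes "f \<in> space M \<rightarrow> unitary_group n"
    and "\<And>i j. i < n \<Longrightarrow> j < n \<Longrightarrow> (\<lambda>x. f x $$ (i, j)) \<in> borel_measurable M"
  shows "f \<in> M \<rightarrow>\<^sub>M borel_unitary n"
  unfolding borel_unitary_def
proof (rule measurable_vimage_algebra2)
  show "(\<lambda>x. \<lambda>(i, j)\<in>{..<n} \<times> {..<n}. f x $$ (i, j)) \<in>
          M \<rightarrow>\<^sub>M PiM ({..<n} \<times> {..<n}) (\<lambda>_. borel)"
    by (rule measurable_restrict) (use assms(2) in auto)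
qed (use assms(1) in auto)

lemma mat_adjoint_dim [simp]:
  "dim_row (mat_adjoint A) = dim_col A" "dim_col (mat_adjoint A) = dim_row A"
  by (auto simp: mat_adjoint_def)

lemma mat_adjoint_index:
  assumes "i < dim_col A" "j < dim_row A"
  shows "mat_adjoint A $$ (i, j) = conjugate (A $$ (j, i))"
  using assms by (simp add: mat_adjoint_def mat_of_rows_index)

lemma mat_adjoint_mult:
  fixes A B :: "complex mat"
  assumes "A \<in> carrier_mat n n" "B \<in> carrier_mat n n"
  shows "mat_adjoint (A * B) = mat_adjoint B * mat_adjoint A"
proof (rule eq_matI)
  fix i j assume "i < dim_row (mat_adjoint B * mat_adjoint A)" "j < dim_col (mat_adjoint B * mat_adjoint A)"
  hence ij: "i < n" "j < n" using assms by auto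
  have d: "dim_row A = n" "dim_col A = n" "dim_row B = n" "dim_col B = n" using assms by auto
  have "mat_adjoint (A * B) $$ (i, j) = (\<Sum>l<n. cnj (A $$ (j, l)) * cnj (B $$ (l, i)))"
    using ij d by (simp add: mat_adjoint_index scalar_prod_def atLeast0LessThan)
  also have "\<dots> = (mat_adjoint B * mat_adjoint A) $$ (i, j)"
    using ij d by (simp add: mat_adjoint_index scalar_prod_def atLeast0LessThan mult.commute)
  finally show "mat_adjoint (A * B) $$ (i, j) = (mat_adjoint B * mat_adjoint A) $$ (i, j)" .
qed (use assms in auto)

lemma unitary_group_mult:
  assumes "V \<in> unitary_group n" "A \<in> unitary_group n"
  shows "V * A \<in> unitary_group n"
proof -
  have c: "V \<in> carrier_mat n n" "A \<in> carrier_mat n n"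
      "mat_adjoint V \<in> carrier_mat n n" "mat_adjoint A \<in> carrier_mat n n"
    and u: "V * mat_adjoint V = 1\<^sub>m n" "mat_adjoint V * V = 1\<^sub>m n"
      "A * mat_adjoint A = 1\<^sub>m n" "mat_adjoint A * A = 1\<^sub>m n"
    using assms by (auto simp: unitary_group_def)
  have VA: "V * A \<in> carrier_mat n n" and adj: "mat_adjoint A * mat_adjoint V \<in> carrier_mat n n"
    using c by auto
  have "(V * A) * (mat_adjoint A * mat_adjoint V) = V * (A * (mat_adjoint A * mat_adjoint V))"
    by (rule assoc_mult_mat[OF c(1,2) adj])
  also have "A * (mat_adjoint A * mat_adjoint V) = A * mat_adjoint A * mat_adjoint V"
    by (rule assoc_mult_mat[OF c(2,4,3), symmetric])
  finally have 1: "(V * A) * (mat_adjoint A * mat_adjoint V) = 1\<^sub>m n"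
    using u left_mult_one_mat[OF c(3)] by simp
  have "(mat_adjoint A * mat_adjoint V) * (V * A) = mat_adjoint A * (mat_adjoint V * (V * A))"
    by (rule assoc_mult_mat[OF c(4,3) VA])
  also have "mat_adjoint V * (V * A) = mat_adjoint V * V * A"
    by (rule assoc_mult_mat[OF c(3,1,2), symmetric])
  finally have 2: "(mat_adjoint A * mat_adjoint V) * (V * A) = 1\<^sub>m n"
    using u left_mult_one_mat[OF c(2)] by simp
  show ?thesis
    using 1 2 VA by (simp add: unitary_group_def mat_adjoint_mult[OF c(1,2)])
qed

lemma measurable_unitary_translation:
  assumes "V \<in> unitary_group n"
  shows "(\<lambda>A. V * A) \<in> borel_unitary n \<rightarrow>\<^sub>M borel_unitary n"
proof (rule measurable_into_borel_unitary)
  show "(\<lambda>A. V * A) \<in> space (borel_unitary n) \<rightarrow> unitary_group n"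
    using unitary_group_mult[OF assms] by auto
  fix i j assume ij: "i < n" "j < n"
  have "(\<lambda>A. \<Sum>l<n. V $$ (i, l) * A $$ (l, j)) \<in> borel_measurable (borel_unitary n)"
    using ij by (intro borel_measurable_sum borel_measurable_times measurable_unitary_entry) auto
  also have "?this \<longleftrightarrow> (\<lambda>A. (V * A) $$ (i, j)) \<in> borel_measurable (borel_unitary n)"
    using ij assms
    by (intro measurable_cong)
       (auto simp: unitary_group_def scalar_prod_def atLeast0LessThan)
  finally show "(\<lambda>A. (V * A) $$ (i, j)) \<in> borel_measurable (borel_unitary n)" .
qed

lemma unitary_entry_norm_le_1:
  assumes "A \<in> unitary_group n" "i < n" "j < n"
  shows "cmod (A $$ (i, j)) \<le> 1"
proof -
  have c: "A \<in> carrier_mat n n" and u: "A * mat_adjoint A = 1\<^sub>m n"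
    using assms by (auto simp: unitary_group_def)
  have "(A * mat_adjoint A) $$ (i, i) = (\<Sum>l<n. A $$ (i, l) * cnj (A $$ (i, l)))"
    using c assms(2) by (auto simp: scalar_prod_def mat_adjoint_index atLeast0LessThan intro!: sum.cong)
  also have "\<dots> = complex_of_real (\<Sum>l<n. (cmod (A $$ (i, l)))\<^sup>2)"
    by (simp add: complex_norm_square[symmetric])
  finally have "(\<Sum>l<n. (cmod (A $$ (i, l)))\<^sup>2) = 1"
    using u assms(2) by (metis index_one_mat(1) of_real_eq_1_iff)
  moreover have "(cmod (A $$ (i, j)))\<^sup>2 \<le> (\<Sum>l<n. (cmod (A $$ (i, l)))\<^sup>2)"
    using assms(3) by (intro member_le_sum) auto
  ultimately have "(cmod (A $$ (i, j)))\<^sup>2 \<le> 1\<^sup>2" by simp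
  thus ?thesis by (rule power2_le_imp_le) simp
qed

lemma integrable_Wg:
  assumes "haar_unitary n \<mu>" "k \<le> n" "\<pi> permutes {1..k}"
  shows "integrable \<mu> (\<lambda>U. (\<Prod>i=1..k. U $$ (i - 1, i - 1)) *
                            cnj (\<Prod>i=1..k. U $$ (i - 1, \<pi> i - 1)))"
proof -
  interpret prob_space \<mu> using assms(1) by (simp add: haar_unitary_def)
  have s: "sets \<mu> = sets (borel_unitary n)" using assms(1) by (simp add: haar_unitary_def)
  have sp: "space \<mu> = unitary_group n" using sets_eq_imp_space_eq[OF s] by simp
  have \<pi>: "\<pi> i - 1 < n" if "i \<in> {1..k}" for i
    using permutes_in_image[OF assms(3), of i] that assms(2) by auto
  have m: "(\<lambda>A. A $$ (i, j)) \<in> borel_measurable \<mu>" if "i < n" "j < n" for i j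
    using measurable_unitary_entry[OF that] measurable_cong_sets[OF s refl] by blast
  have "cmod ((\<Prod>i=1..k. U $$ (i - 1, i - 1)) * cnj (\<Prod>i=1..k. U $$ (i - 1, \<pi> i - 1))) \<le> 1"
    if "U \<in> space \<mu>" for U
  proof -
    have "(\<Prod>i=1..k. cmod (U $$ (i - 1, i - 1))) \<le> 1" "(\<Prod>i=1..k. cmod (U $$ (i - 1, \<pi> i - 1))) \<le> 1"
      using that assms(2) \<pi> sp by (intro prod_le_1 conjI unitary_entry_norm_le_1[of _ n]; force)+
    thus ?thesis by (simp add: norm_mult prod_norm[symmetric] mult_le_one prod_nonneg)
  qed
  moreover have "(\<lambda>U. (\<Prod>i=1..k. U $$ (i - 1, i - 1)) *
      cnj (\<Prod>i=1..k. U $$ (i - 1, \<pi> i - 1))) \<in> borel_measurable \<mu>"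
    unfolding cnj_prod using assms(2) \<pi>
    by (intro borel_measurable_times borel_measurable_prod
        borel_measurable_continuous_on[OF continuous_on_cnj[OF continuous_on_id]] m) force+
  ultimately show ?thesis
    by (intro integrable_const_bound[of _ 1]) auto
qed

end

theory Submission
  imports Defs
begin

text \<open>
  The recursion comes from randomizing the first \<open>n - 1\<close> rows. Put \<open>m = n - 1\<close> and let \<open>U\<close> and \<open>V\<close>
  be independent Haar matrices in \<open>U(n)\<close> and \<open>U(m)\<close>. The matrix \<open>(V \<oplus> 1) U\<close> is again Haar, has the
  same last row as \<open>U\<close>, and its other rows are linear in the entries of \<open>V\<close>. Taking the expectation
  over \<open>V\<close> first, a product of \<open>m\<close> entries of \<open>V\<close> and \<open>m\<close> conjugate entries, one of each in every row,
  is a sum of values of \<open>Wg\<^sub>m\<^sub>,\<^sub>m\<close> (\<open>haar_moment_expansion\<close>). What remains for each \<open>\<sigma> \<in> S\<^sub>m\<close>, with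
  \<open>\<tau> = \<sigma>\<inverse>\<close>, is a product over \<open>i \<le> m\<close> of inner products of the columns \<open>i\<close> and \<open>\<pi>(\<tau>(i))\<close> of \<open>U\<close>
  with the last entry removed. By unitarity such an inner product is
  \<open>\<delta>(i, \<pi>(\<tau>(i))) - u(n, i) * cnj (u(n, \<pi>(\<tau>(i))))\<close>, so that only the last row of \<open>U\<close> is left. Expanding the
  product over the set \<open>T\<close> of factors where \<open>\<delta>\<close> is chosen, \<open>T\<close> ranges over sets of fixed points of
  \<open>\<pi> \<circ> \<tau>\<close>, and the remaining entries pair up to \<open>\<Prod>\<^sub>i\<^sub>\<notin>\<^sub>T \<bar>u(n, i)\<bar>\<^sup>2\<close>, whose expectation is the reciprocal of
  the rising factorial of \<open>n\<close> of length \<open>n - \<bar>T\<bar>\<close> (\<open>haar_row_moment\<close>). This is \<open>a\<^sub>n(\<pi>, \<tau>)\<close>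
  (\<open>haar_last_row_expectation\<close>), and \<open>Wg(\<sigma>) = Wg(\<tau>)\<close> finishes the argument (\<open>Wg_inverse\<close>).

  Both moment formulas rest on invariance of the Haar measure under right translations, which
  follows from left invariance through uniqueness (\<open>haar_unitary_unique\<close>). Invariance under diagonal
  matrices makes a moment vanish unless each column is used equally often with and without
  conjugation. Invariance under rotations of two coordinates, to first order in the angle, expresses
  a moment in which a column is repeated through moments in which one of its occurrences is moved to
  an unused column; iterating this leads to moments with distinct columns, and those are permuted
  into each other by permutation matrices.
\<close>

section \<open>Counting and linear-coefficient lemmas\<close>

text \<open>
  This form fits the expansion of a product \<open>\<Prod>\<^sub>k (t * d\<^sub>k + w\<^sub>k)\<close> over the set \<open>S\<close> of factors that
  contribute \<open>t * d\<^sub>k\<close>: a polynomial in \<open>t\<close> with infinitely many zeros is zero, and its linear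
  coefficient collects the singletons. It replaces differentiation under the integral sign.
\<close>

lemma poly_vanishing_linear_coeff:
  fixes C :: "'k set \<Rightarrow> complex"
  assumes K: "finite K" and van: "\<And>t::real. (\<Sum>S\<in>Pow K. of_real t ^ card S * C S) = 0"
  shows "(\<Sum>k\<in>K. C {k}) = 0"
proof -
  define f where "f t = (\<Sum>S\<in>Pow K. t ^ card S * C S)" for t :: complex
  define p where "p = (\<Sum>S\<in>Pow K. monom (C S) (card S))"
  have poly: "poly p t = f t" for t
    by (simp add: p_def f_def poly_sum poly_monom mult.commute)
  have "p = 0"
  proof (rule ccontr)
    assume "p \<noteq> 0"
    then have "finite {x. poly p x = 0}" by (rule poly_roots_finite)
    moreover have "range complex_of_real \<subseteq> {x. poly p x = 0}"
      using van by (auto simp: poly f_def)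
    moreover have "infinite (range complex_of_real)"
      by (simp add: finite_image_iff inj_of_real infinite_UNIV_char_0)
    ultimately show False using finite_subset by blast
  qed
  then have "0 = coeff p 1" by simp
  also have "\<dots> = (\<Sum>S\<in>Pow K. if card S = 1 then C S else 0)"
    unfolding p_def by (simp add: coeff_sum coeff_monom)
  also have "\<dots> = (\<Sum>S\<in>{S \<in> Pow K. card S = 1}. C S)"
    using K by (intro sum.mono_neutral_cong_right) auto
  also have "{S \<in> Pow K. card S = 1} = (\<lambda>k. {k}) ` K"
    by (auto simp: card_1_singleton_iff)
  also have "(\<Sum>S\<in>\<dots>. C S) = (\<Sum>k\<in>K. C {k})"
    by (subst sum.reindex) auto
  finally show ?thesis by simp
qed

text \<open>
  The complements of the images of \<open>e\<close> and \<open>j\<close> in \<open>{..<n}\<close> have equal size, so the partial bijection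
  between the images extends.
\<close>

lemma permutes_extending_injections:
  assumes finI: "finite I" and e: "inj_on e I" "e ` I \<subseteq> {..<n::nat}"
    and j: "inj_on j I" "j ` I \<subseteq> {..<n}"
  obtains p where "p permutes {..<n}" "\<And>i. i \<in> I \<Longrightarrow> p (e i) = j i"
proof -
  have f: "bij_betw (j \<circ> inv_into I e) (e ` I) (j ` I)"
    using e j by (intro bij_betw_trans[OF bij_betw_inv_into]) (auto simp: bij_betw_def)
  have "card ({..<n} - e ` I) = card ({..<n} - j ` I)"
    using e j finI by (simp add: card_Diff_subset card_image)
  then obtain g where g: "bij_betw g ({..<n} - e ` I) ({..<n} - j ` I)"
    by (metis finite_Diff finite_lessThan finite_same_card_bij)
  define p where "p x = (if x \<in> e ` I then (j \<circ> inv_into I e) x else if x < n then g x else x)" for x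
  have "bij_betw p (e ` I \<union> ({..<n} - e ` I)) (j ` I \<union> ({..<n} - j ` I))"
  proof (rule bij_betw_combine)
    show "bij_betw p (e ` I) (j ` I)" using f by (rule bij_betw_cong[THEN iffD1, rotated]) (simp add: p_def)
    show "bij_betw p ({..<n} - e ` I) ({..<n} - j ` I)"
      using g by (rule bij_betw_cong[THEN iffD1, rotated]) (simp add: p_def)
  qed auto
  moreover have "e ` I \<union> ({..<n} - e ` I) = {..<n}" "j ` I \<union> ({..<n} - j ` I) = {..<n}"
    using e j by auto
  ultimately have "p permutes {..<n}"
    using e(2) by (intro bij_imp_permutes) (auto simp: p_def)
  moreover have "p (e i) = j i" if "i \<in> I" for i
    using that e(1) by (simp add: p_def)
  ultimately show thesis using that by blast
qed

text \<open>
  Sending \<open>a\<close> to \<open>b\<close> and fixing everything else merges at most the two points \<open>a\<close> and \<open>b\<close>, so only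
  the identity and, for \<open>b \<in> S\<close>, their transposition preserve the fibres. In the row moments this is
  the source of \<open>E\<bar>u\<bar>\<^sup>4 = 2 E(\<bar>u\<bar>\<^sup>2\<bar>u'\<bar>\<^sup>2)\<close>.
\<close>

lemma card_stabilizer_merged_point:
  assumes S: "finite S" "a \<notin> S"
  shows "card {\<sigma>. \<sigma> permutes insert a S \<and>
      (\<forall>i\<in>insert a S. ((\<lambda>c. c)(a := b)) i = ((\<lambda>c. c)(a := b)) (\<sigma> i))} = (if b \<in> S then 2 else 1)"
    (is "card ?P = _")
proof (cases "b \<in> S")
  case True
  have "?P = {id, Transposition.transpose a b}"
  proof (intro equalityI subsetI)
    fix \<sigma> assume "\<sigma> \<in> ?P"
    then have \<sigma>: "\<sigma> permutes insert a S"
      and *: "\<And>i. i \<in> insert a S \<Longrightarrow> ((\<lambda>c. c)(a := b)) i = ((\<lambda>c. c)(a := b)) (\<sigma> i)" by auto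
    have "\<sigma> permutes {a, b}"
    proof (rule permutes_superset[OF \<sigma>])
      fix i assume "i \<in> insert a S - {a, b}"
      then show "\<sigma> i = i" using *[of i] by (auto split: if_splits)
    qed
    then show "\<sigma> \<in> {id, Transposition.transpose a b}" by (simp add: permutes_doubleton_iff)
  next
    fix \<sigma> assume "\<sigma> \<in> {id, Transposition.transpose a b}"
    moreover have "Transposition.transpose a b permutes insert a S"
      using True by (intro permutes_swap_id) auto
    ultimately show "\<sigma> \<in> ?P"
      using permutes_id by (auto simp: Transposition.transpose_def split: if_splits)
  qed
  moreover have "id \<noteq> Transposition.transpose a b"
    using True S(2) by (auto simp: fun_eq_iff Transposition.transpose_def)
  ultimately show ?thesis using True by simp
next
  case False
  have "?P = {id}"
  proof (intro equalityI subsetI)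
    fix \<sigma> assume "\<sigma> \<in> ?P"
    then have \<sigma>: "\<sigma> permutes insert a S"
      and *: "\<And>i. i \<in> insert a S \<Longrightarrow> ((\<lambda>c. c)(a := b)) i = ((\<lambda>c. c)(a := b)) (\<sigma> i)" by auto
    have "\<sigma> permutes {a}"
    proof (rule permutes_superset[OF \<sigma>])
      fix i assume i: "i \<in> insert a S - {a}"
      then show "\<sigma> i = i" using *[of i] False by (auto split: if_splits)
    qed
    then show "\<sigma> \<in> {id}" by simp
  qed (auto simp: permutes_id)
  then show ?thesis using False by simp
qed

lemma sum_Pow_by_card:
  fixes h :: "nat \<Rightarrow> complex"
  assumes F: "finite F"
  shows "(\<Sum>T\<in>Pow F. h (card T)) = (\<Sum>t=0..card F. of_nat (card F choose t) * h t)"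
proof -
  have "(\<Sum>T\<in>Pow F. h (card T)) =
      (\<Sum>t\<in>{0..card F}. \<Sum>T\<in>{T \<in> Pow F. card T = t}. h (card T))"
    by (rule sum.group[symmetric]) (use F in \<open>auto intro: card_mono\<close>)
  also have "\<dots> = (\<Sum>t=0..card F. of_nat (card F choose t) * h t)"
  proof (rule sum.cong)
    fix t
    have "{T \<in> Pow F. card T = t} = {T. T \<subseteq> F \<and> card T = t}" by auto
    then show "(\<Sum>T\<in>{T \<in> Pow F. card T = t}. h (card T)) = of_nat (card F choose t) * h t"
      using n_subsets[OF F, of t] by simp
  qed simp
  finally show ?thesis .
qed

section \<open>Unitary matrices\<close>

lemma unitary_groupI:
  fixes A :: "complex mat"
  assumes A: "A \<in> carrier_mat n n"
    and orth: "\<And>i j. i < n \<Longrightarrow> j < n \<Longrightarrow>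
      (\<Sum>p<n. cnj (A $$ (p, i)) * A $$ (p, j)) = (if i = j then 1 else 0)"
  shows "A \<in> unitary_group n"
proof -
  have adj: "mat_adjoint A \<in> carrier_mat n n" using A by auto
  have "mat_adjoint A * A = 1\<^sub>m n"
    using A orth by (intro eq_matI) (auto simp: scalar_prod_def mat_adjoint_index atLeast0LessThan)
  with mat_mult_left_right_inverse[OF adj A this] A show ?thesis
    by (simp add: unitary_group_def)
qed

lemma unitary_columns_orthonormal:
  assumes "A \<in> unitary_group n" "i < n" "j < n"
  shows "(\<Sum>p<n. cnj (A $$ (p, i)) * A $$ (p, j)) = (if i = j then 1 else 0)"
proof -
  have c: "A \<in> carrier_mat n n" and u: "mat_adjoint A * A = 1\<^sub>m n"
    using assms by (auto simp: unitary_group_def)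
  have "(mat_adjoint A * A) $$ (i, j) = (\<Sum>p<n. cnj (A $$ (p, i)) * A $$ (p, j))"
    using c assms by (auto simp: scalar_prod_def mat_adjoint_index atLeast0LessThan intro!: sum.cong)
  with u assms show ?thesis by (simp split: if_splits)
qed

lemma unitary_rows_orthonormal:
  assumes "A \<in> unitary_group n" "i < n" "j < n"
  shows "(\<Sum>p<n. A $$ (i, p) * cnj (A $$ (j, p))) = (if i = j then 1 else 0)"
proof -
  have c: "A \<in> carrier_mat n n" and u: "A * mat_adjoint A = 1\<^sub>m n"
    using assms by (auto simp: unitary_group_def)
  have "(A * mat_adjoint A) $$ (i, j) = (\<Sum>p<n. A $$ (i, p) * cnj (A $$ (j, p)))"
    using c assms by (auto simp: scalar_prod_def mat_adjoint_index atLeast0LessThan intro!: sum.cong)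
  with u assms show ?thesis by (simp split: if_splits)
qed

lemma unitary_group_carrier: "A \<in> unitary_group n \<Longrightarrow> A \<in> carrier_mat n n"
  by (simp add: unitary_group_def)

lemma mat_adjoint_adjoint: "mat_adjoint (mat_adjoint A) = (A :: complex mat)"
  by (rule eq_matI) (auto simp: mat_adjoint_index)

lemma unitary_group_adjoint: "A \<in> unitary_group n \<Longrightarrow> mat_adjoint A \<in> unitary_group n"
  by (auto simp: unitary_group_def mat_adjoint_adjoint)

lemma mult_mat_entry:
  "A \<in> carrier_mat n n \<Longrightarrow> B \<in> carrier_mat n n \<Longrightarrow> i < n \<Longrightarrow> j < n \<Longrightarrow>
    (A * B) $$ (i, j) = (\<Sum>p<n. A $$ (i, p) * B $$ (p, j))"
  by (auto simp: scalar_prod_def atLeast0LessThan)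

lemma borel_measurable_cnj: "f \<in> borel_measurable M \<Longrightarrow> (\<lambda>x. cnj (f x)) \<in> borel_measurable M"
  by (rule borel_measurable_continuous_on[OF continuous_on_cnj[OF continuous_on_id]])

lemma measurable_adjoint: "mat_adjoint \<in> borel_unitary n \<rightarrow>\<^sub>M borel_unitary n"
proof (rule measurable_into_borel_unitary)
  show "mat_adjoint \<in> space (borel_unitary n) \<rightarrow> unitary_group n"
    using unitary_group_adjoint by auto
  fix i j assume ij: "i < n" "j < n"
  have "(\<lambda>A. cnj (A $$ (j, i))) \<in> borel_measurable (borel_unitary n)"
    using ij by (intro borel_measurable_cnj measurable_unitary_entry)
  also have "?this \<longleftrightarrow> (\<lambda>A. mat_adjoint A $$ (i, j)) \<in> borel_measurable (borel_unitary n)"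
    using ij by (intro measurable_cong) (auto simp: unitary_group_def mat_adjoint_index)
  finally show "(\<lambda>A. mat_adjoint A $$ (i, j)) \<in> borel_measurable (borel_unitary n)" .
qed

lemma measurable_unitary_mult:
  assumes f: "f \<in> M \<rightarrow>\<^sub>M borel_unitary n" and g: "g \<in> M \<rightarrow>\<^sub>M borel_unitary n"
  shows "(\<lambda>x. f x * g x) \<in> M \<rightarrow>\<^sub>M borel_unitary n"
proof (rule measurable_into_borel_unitary)
  have fg: "f x \<in> unitary_group n" "g x \<in> unitary_group n" if "x \<in> space M" for x
    using measurable_space[OF f that] measurable_space[OF g that] by auto
  then show "(\<lambda>x. f x * g x) \<in> space M \<rightarrow> unitary_group n"
    by (auto intro: unitary_group_mult)
  fix i j assume ij: "i < n" "j < n"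
  have "(\<lambda>x. \<Sum>p<n. f x $$ (i, p) * g x $$ (p, j)) \<in> borel_measurable M"
    using ij by (intro borel_measurable_sum borel_measurable_times
        measurable_compose[OF f measurable_unitary_entry]
        measurable_compose[OF g measurable_unitary_entry]) auto
  also have "?this \<longleftrightarrow> (\<lambda>x. (f x * g x) $$ (i, j)) \<in> borel_measurable M"
    using ij fg by (intro measurable_cong mult_mat_entry[symmetric])
        (auto dest: unitary_group_carrier)
  finally show "(\<lambda>x. (f x * g x) $$ (i, j)) \<in> borel_measurable M" .
qed

lemma unitary_group_adjoint_mult_cancel:
  assumes "A \<in> unitary_group n" "B \<in> unitary_group n"
  shows "mat_adjoint (A * B) * A = mat_adjoint B"
proof -
  have c: "A \<in> carrier_mat n n" "B \<in> carrier_mat n n" "mat_adjoint A \<in> carrier_mat n n"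
    "mat_adjoint B \<in> carrier_mat n n" and u: "mat_adjoint A * A = 1\<^sub>m n"
    using assms by (auto simp: unitary_group_def)
  have "mat_adjoint (A * B) * A = mat_adjoint B * (mat_adjoint A * A)"
    unfolding mat_adjoint_mult[OF c(1,2)] by (rule assoc_mult_mat[OF c(4,3,1)])
  then show ?thesis using u c by simp
qed

lemma unitary_group_map_cnj:
  assumes "A \<in> unitary_group n"
  shows "map_mat cnj A \<in> unitary_group n"
proof (rule unitary_groupI)
  fix i j assume ij: "i < n" "j < n"
  have "(\<Sum>p<n. cnj (map_mat cnj A $$ (p, i)) * map_mat cnj A $$ (p, j))
      = (\<Sum>p<n. cnj (A $$ (p, j)) * A $$ (p, i))"
    using ij unitary_group_carrier[OF assms] by (intro sum.cong) auto
  then show "(\<Sum>p<n. cnj (map_mat cnj A $$ (p, i)) * map_mat cnj A $$ (p, j))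
      = (if i = j then 1 else 0)"
    using unitary_columns_orthonormal[OF assms ij(2,1)] by auto
qed (use unitary_group_carrier[OF assms] in auto)

lemma measurable_map_mat_cnj: "map_mat cnj \<in> borel_unitary n \<rightarrow>\<^sub>M borel_unitary n"
proof (rule measurable_into_borel_unitary)
  fix i j assume ij: "i < n" "j < n"
  have "(\<lambda>A. cnj (A $$ (i, j))) \<in> borel_measurable (borel_unitary n)"
    using ij by (intro borel_measurable_cnj measurable_unitary_entry)
  also have "?this \<longleftrightarrow> (\<lambda>A. map_mat cnj A $$ (i, j)) \<in> borel_measurable (borel_unitary n)"
    using ij by (intro measurable_cong) (auto simp: unitary_group_def)
  finally show "(\<lambda>A. map_mat cnj A $$ (i, j)) \<in> borel_measurable (borel_unitary n)" .
qed (use unitary_group_map_cnj in auto)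

text \<open>
  \<open>W\<close> is the block matrix \<open>V \<oplus> 1\<close>. Multiplying by it mixes the first \<open>m\<close> rows and keeps the last one.
\<close>

lemma unitary_block_embedding:
  assumes V: "V \<in> unitary_group m"
  defines "W \<equiv> mat (Suc m) (Suc m) (\<lambda>(i, j). if i < m \<and> j < m then V $$ (i, j) else if i = j then 1 else 0)"
  shows "W \<in> unitary_group (Suc m)"
    and "\<And>U i j. U \<in> carrier_mat (Suc m) (Suc m) \<Longrightarrow> i < m \<Longrightarrow> j < Suc m \<Longrightarrow>
      (W * U) $$ (i, j) = (\<Sum>p<m. V $$ (i, p) * U $$ (p, j))"
    and "\<And>U j. U \<in> carrier_mat (Suc m) (Suc m) \<Longrightarrow> j < Suc m \<Longrightarrow> (W * U) $$ (m, j) = U $$ (m, j)"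
proof -
  have W: "W \<in> carrier_mat (Suc m) (Suc m)" by (simp add: W_def)
  have entry: "W $$ (i, j) = (if i < m \<and> j < m then V $$ (i, j) else if i = j then 1 else 0)"
    if "i < Suc m" "j < Suc m" for i j using that by (simp add: W_def)
  show "W \<in> unitary_group (Suc m)"
  proof (rule unitary_groupI[OF W])
    fix i j assume ij: "i < Suc m" "j < Suc m"
    have "(\<Sum>p<m. cnj (W $$ (p, i)) * W $$ (p, j)) = (if i < m \<and> j < m then if i = j then 1 else 0 else 0)"
    proof (cases "i < m \<and> j < m")
      case True
      then have "(\<Sum>p<m. cnj (W $$ (p, i)) * W $$ (p, j)) = (\<Sum>p<m. cnj (V $$ (p, i)) * V $$ (p, j))"
        by (intro sum.cong) (auto simp: entry)
      then show ?thesis using unitary_columns_orthonormal[OF V, of i j] True by simp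
    next
      case False
      then show ?thesis using ij by (auto simp: entry intro!: sum.neutral)
    qed
    then show "(\<Sum>p<Suc m. cnj (W $$ (p, i)) * W $$ (p, j)) = (if i = j then 1 else 0)"
      using ij by (auto simp: entry)
  qed
  fix U :: "complex mat" and j assume U: "U \<in> carrier_mat (Suc m) (Suc m)" and j: "j < Suc m"
  show "(W * U) $$ (m, j) = U $$ (m, j)"
    using j by (simp add: mult_mat_entry[OF W U] entry)
  fix i assume "i < m"
  then show "(W * U) $$ (i, j) = (\<Sum>p<m. V $$ (i, p) * U $$ (p, j))"
    using j by (simp add: mult_mat_entry[OF W U] entry)
qed

section \<open>Uniqueness and symmetries of Haar measure\<close>

lemma haar_space: "haar_unitary n \<mu> \<Longrightarrow> space \<mu> = unitary_group n"
  using sets_eq_imp_space_eq[of \<mu> "borel_unitary n"] by (simp add: haar_unitary_def)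

lemma measurable_haar_cong:
  "haar_unitary n \<mu> \<Longrightarrow> measurable \<mu> M = measurable (borel_unitary n) M"
  "haar_unitary n \<mu> \<Longrightarrow> measurable M \<mu> = measurable M (borel_unitary n)"
  by (rule measurable_cong_sets; simp add: haar_unitary_def)+

lemma haar_emeasure_translate:
  assumes "haar_unitary n \<mu>" "V \<in> unitary_group n" "S \<in> sets (borel_unitary n)"
  shows "emeasure \<mu> ((\<lambda>A. V * A) -` S \<inter> unitary_group n) = emeasure \<mu> S"
proof -
  have "emeasure \<mu> S = emeasure (distr \<mu> \<mu> (\<lambda>A. V * A)) S"
    using assms by (simp add: haar_unitary_def)
  also have "\<dots> = emeasure \<mu> ((\<lambda>A. V * A) -` S \<inter> space \<mu>)"
    using assms by (intro emeasure_distr)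
      (auto simp: measurable_haar_cong measurable_unitary_translation haar_unitary_def)
  finally show ?thesis using haar_space[OF assms(1)] by simp
qed

text \<open>
  Both sides are the probability that \<open>B\<^sup>* A \<in> S\<close> for independent \<open>A\<close> and \<open>B\<close>, computed in the two orders
  of integration. For fixed \<open>B\<close>, left invariance of the law of \<open>A\<close> removes \<open>B\<^sup>*\<close>; for fixed \<open>A\<close>,
  substituting \<open>A B\<close> for \<open>B\<close> turns \<open>B\<^sup>* A\<close> into \<open>B\<^sup>*\<close>.
\<close>

lemma haar_emeasure_adjoint:
  assumes \<mu>: "haar_unitary n \<mu>" and \<nu>: "haar_unitary n \<nu>" and S: "S \<in> sets (borel_unitary n)"
  shows "emeasure \<mu> S = emeasure \<nu> (mat_adjoint -` S \<inter> unitary_group n)"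
proof -
  interpret M: prob_space \<mu> using \<mu> by (simp add: haar_unitary_def)
  interpret N: prob_space \<nu> using \<nu> by (simp add: haar_unitary_def)
  interpret pair_prob_space \<mu> \<nu> ..
  note sp = haar_space[OF \<mu>] haar_space[OF \<nu>]
  let ?T = "{x \<in> space (\<mu> \<Otimes>\<^sub>M \<nu>). mat_adjoint (snd x) * fst x \<in> S}"
  have "(\<lambda>x. mat_adjoint (snd x) * fst x) \<in> \<mu> \<Otimes>\<^sub>M \<nu> \<rightarrow>\<^sub>M borel_unitary n"
    by (intro measurable_unitary_mult measurable_compose[OF _ measurable_adjoint])
      (auto simp flip: measurable_haar_cong(2)[OF \<mu>], simp add: measurable_haar_cong(2)[OF \<mu>] flip: measurable_haar_cong(2)[OF \<nu>])
  from measurable_sets[OF this S]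
  have T: "?T \<in> sets (\<mu> \<Otimes>\<^sub>M \<nu>)"
    by (simp add: vimage_def Int_def conj_commute)
  have "emeasure (\<mu> \<Otimes>\<^sub>M \<nu>) ?T = (\<integral>\<^sup>+B. emeasure \<mu> ((\<lambda>A. (A, B)) -` ?T) \<partial>\<nu>)"
    by (rule emeasure_pair_measure_alt2[OF T])
  also have "\<dots> = (\<integral>\<^sup>+B. emeasure \<mu> S \<partial>\<nu>)"
  proof (rule nn_integral_cong)
    fix B assume "B \<in> space \<nu>"
    then have B: "B \<in> unitary_group n" by (simp add: sp)
    have "(\<lambda>A. (A, B)) -` ?T = (\<lambda>A. mat_adjoint B * A) -` S \<inter> unitary_group n"
      using B by (auto simp: space_pair_measure sp)
    then show "emeasure \<mu> ((\<lambda>A. (A, B)) -` ?T) = emeasure \<mu> S"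
      using haar_emeasure_translate[OF \<mu> unitary_group_adjoint[OF B] S] by simp
  qed
  also have "\<dots> = emeasure \<mu> S" by (simp add: N.emeasure_space_1)
  finally have 1: "emeasure (\<mu> \<Otimes>\<^sub>M \<nu>) ?T = emeasure \<mu> S" .
  have S': "mat_adjoint -` S \<inter> unitary_group n \<in> sets (borel_unitary n)"
    using measurable_sets[OF measurable_adjoint S] by simp
  have "emeasure (\<mu> \<Otimes>\<^sub>M \<nu>) ?T = (\<integral>\<^sup>+A. emeasure \<nu> (Pair A -` ?T) \<partial>\<mu>)"
    by (rule N.emeasure_pair_measure_alt[OF T])
  also have "\<dots> = (\<integral>\<^sup>+A. emeasure \<nu> (mat_adjoint -` S \<inter> unitary_group n) \<partial>\<mu>)"
  proof (rule nn_integral_cong)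
    fix A assume "A \<in> space \<mu>"
    then have A: "A \<in> unitary_group n" by (simp add: sp)
    let ?Q = "Pair A -` ?T"
    have Q: "?Q \<in> sets (borel_unitary n)"
      using sets_Pair1[OF T, of A] \<nu> by (simp add: haar_unitary_def)
    have Q_eq: "?Q = {B \<in> unitary_group n. mat_adjoint B * A \<in> S}"
      using A by (auto simp: space_pair_measure sp)
    have "(\<lambda>B. A * B) -` ?Q \<inter> unitary_group n = mat_adjoint -` S \<inter> unitary_group n"
      unfolding Q_eq using A
      by (auto simp: unitary_group_adjoint_mult_cancel unitary_group_mult)
    then show "emeasure \<nu> ?Q = emeasure \<nu> (mat_adjoint -` S \<inter> unitary_group n)"
      using haar_emeasure_translate[OF \<nu> A Q] by simp
  qed
  also have "\<dots> = emeasure \<nu> (mat_adjoint -` S \<inter> unitary_group n)"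
    by (simp add: M.emeasure_space_1)
  finally show ?thesis using 1 by simp
qed

text \<open>
  The right-hand side of \<open>haar_emeasure_adjoint\<close> does not depend on \<open>\<mu>\<close>.
\<close>

theorem haar_unitary_unique:
  assumes "haar_unitary n \<mu>" "haar_unitary n \<nu>"
  shows "\<mu> = \<nu>"
proof (rule measure_eqI)
  show "sets \<mu> = sets \<nu>" using assms by (simp add: haar_unitary_def)
  fix S assume "S \<in> sets \<mu>"
  then have S: "S \<in> sets (borel_unitary n)" using assms by (simp add: haar_unitary_def)
  show "emeasure \<mu> S = emeasure \<nu> S"
    using haar_emeasure_adjoint[OF assms(1,2) S] haar_emeasure_adjoint[OF assms(2,2) S] by simp
qed

text \<open>
  If \<open>f\<close> intertwines every left translation with some left translation, then the image of Haar
  measure under \<open>f\<close> is left invariant again, hence equal to it by uniqueness.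
\<close>

lemma haar_distr_invariant:
  assumes \<mu>: "haar_unitary n \<mu>" and f: "f \<in> borel_unitary n \<rightarrow>\<^sub>M borel_unitary n"
    and comm: "\<And>V. V \<in> unitary_group n \<Longrightarrow>
      \<exists>W\<in>unitary_group n. \<forall>A\<in>unitary_group n. V * f A = f (W * A)"
  shows "distr \<mu> \<mu> f = \<mu>"
proof (rule haar_unitary_unique[OF _ \<mu>])
  interpret prob_space \<mu> using \<mu> by (simp add: haar_unitary_def)
  have fm: "f \<in> \<mu> \<rightarrow>\<^sub>M \<mu>" using f by (simp add: measurable_haar_cong[OF \<mu>])
  have tm: "(\<lambda>A. V * A) \<in> \<mu> \<rightarrow>\<^sub>M \<mu>" if "V \<in> unitary_group n" for V
    using measurable_unitary_translation[OF that] by (simp add: measurable_haar_cong[OF \<mu>])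
  have "distr (distr \<mu> \<mu> f) (distr \<mu> \<mu> f) (\<lambda>A. V * A) = distr \<mu> \<mu> f"
    if V: "V \<in> unitary_group n" for V
  proof -
    obtain W where W: "W \<in> unitary_group n"
      and *: "\<And>A. A \<in> unitary_group n \<Longrightarrow> V * f A = f (W * A)"
      using comm[OF V] by blast
    have "distr (distr \<mu> \<mu> f) (distr \<mu> \<mu> f) (\<lambda>A. V * A) = distr (distr \<mu> \<mu> f) \<mu> (\<lambda>A. V * A)"
      by (rule distr_cong) auto
    also have "\<dots> = distr \<mu> \<mu> (\<lambda>A. V * f A)"
      by (simp add: distr_distr[OF tm[OF V] fm] comp_def)
    also have "\<dots> = distr \<mu> \<mu> (\<lambda>A. f (W * A))"
      by (rule distr_cong) (auto simp: haar_space[OF \<mu>] *)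
    also have "\<dots> = distr (distr \<mu> \<mu> (\<lambda>A. W * A)) \<mu> f"
      by (simp add: distr_distr[OF fm tm[OF W]] comp_def)
    also have "\<dots> = distr \<mu> \<mu> f"
      using \<mu> W by (simp add: haar_unitary_def)
    finally show ?thesis .
  qed
  then show "haar_unitary n (distr \<mu> \<mu> f)"
    using \<mu> prob_space_distr[OF fm] by (simp add: haar_unitary_def)
qed

lemma haar_right_invariant:
  assumes \<mu>: "haar_unitary n \<mu>" and V: "V \<in> unitary_group n"
  shows "distr \<mu> \<mu> (\<lambda>A. A * V) = \<mu>"
proof (rule haar_distr_invariant[OF \<mu>])
  show "(\<lambda>A. A * V) \<in> borel_unitary n \<rightarrow>\<^sub>M borel_unitary n"
    using V by (intro measurable_unitary_mult) auto
  fix W assume "W \<in> unitary_group n"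
  then show "\<exists>W'\<in>unitary_group n. \<forall>A\<in>unitary_group n. W * (A * V) = W' * A * V"
    using V by (intro bexI[of _ W]) (auto simp: unitary_group_def)
qed

lemma haar_conjugate_invariant:
  assumes \<mu>: "haar_unitary n \<mu>"
  shows "distr \<mu> \<mu> (map_mat cnj) = \<mu>"
proof (rule haar_distr_invariant[OF \<mu> measurable_map_mat_cnj])
  fix V assume V: "V \<in> unitary_group n"
  have "V * map_mat cnj A = map_mat cnj (map_mat cnj V * A)" if "A \<in> unitary_group n" for A
    using unitary_group_carrier[OF that] unitary_group_carrier[OF V]
    by (intro eq_matI) (auto simp: scalar_prod_def)
  then show "\<exists>W\<in>unitary_group n. \<forall>A\<in>unitary_group n. V * map_mat cnj A = map_mat cnj (W * A)"
    using unitary_group_map_cnj[OF V] by blast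
qed

lemma haar_integral_invariant:
  fixes g :: "complex mat \<Rightarrow> complex"
  assumes \<mu>: "haar_unitary n \<mu>" and inv: "distr \<mu> \<mu> f = \<mu>" and f: "f \<in> borel_unitary n \<rightarrow>\<^sub>M borel_unitary n"
    and g: "g \<in> borel_measurable (borel_unitary n)"
  shows "(\<integral>U. g (f U) \<partial>\<mu>) = (\<integral>U. g U \<partial>\<mu>)"
proof -
  have "(\<integral>U. g U \<partial>\<mu>) = (\<integral>U. g U \<partial>distr \<mu> \<mu> f)" by (simp add: inv)
  also have "\<dots> = (\<integral>U. g (f U) \<partial>\<mu>)"
    using f g by (intro integral_distr) (simp_all add: measurable_haar_cong[OF \<mu>])
  finally show ?thesis by simp
qed

section \<open>Mixed moments of the entries\<close>

text \<open>
  Rows and columns are families indexed by an arbitrary set \<open>I\<close>, and the rows \<open>r\<close> and \<open>s\<close> of the plain and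
  of the conjugate factors are separate, since right translations act on columns only.
\<close>

definition haar_moment :: "complex mat measure \<Rightarrow> 'a set \<Rightarrow> ('a \<Rightarrow> nat) \<Rightarrow> ('a \<Rightarrow> nat)
    \<Rightarrow> ('a \<Rightarrow> nat) \<Rightarrow> ('a \<Rightarrow> nat) \<Rightarrow> complex" where
  "haar_moment \<mu> I r s j l = (\<integral>U. (\<Prod>i\<in>I. U $$ (r i, j i) * cnj (U $$ (s i, l i))) \<partial>\<mu>)"

lemma haar_moment_cong:
  assumes "\<And>i. i \<in> I \<Longrightarrow> r i = r' i" "\<And>i. i \<in> I \<Longrightarrow> s i = s' i"
    "\<And>i. i \<in> I \<Longrightarrow> j i = j' i" "\<And>i. i \<in> I \<Longrightarrow> l i = l' i"
  shows "haar_moment \<mu> I r s j l = haar_moment \<mu> I r' s' j' l'"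
  unfolding haar_moment_def using assms by (simp cong: prod.cong)

lemma integrable_bounded_prod:
  fixes f :: "'k \<Rightarrow> complex mat \<Rightarrow> complex"
  assumes \<mu>: "haar_unitary n \<mu>"
    and m: "\<And>k. k \<in> K \<Longrightarrow> f k \<in> borel_measurable (borel_unitary n)"
    and b: "\<And>k U. k \<in> K \<Longrightarrow> U \<in> unitary_group n \<Longrightarrow> cmod (f k U) \<le> 1"
  shows "integrable \<mu> (\<lambda>U. \<Prod>k\<in>K. f k U)"
proof -
  interpret prob_space \<mu> using \<mu> by (simp add: haar_unitary_def)
  have "cmod (\<Prod>k\<in>K. f k U) \<le> 1" if "U \<in> unitary_group n" for U
    unfolding prod_norm[symmetric] using b that by (intro prod_le_1) auto
  moreover have "(\<lambda>U. \<Prod>k\<in>K. f k U) \<in> borel_measurable \<mu>"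
    using m by (simp add: measurable_haar_cong[OF \<mu>])
  ultimately show ?thesis
    by (intro integrable_const_bound[of _ 1]) (auto simp: haar_space[OF \<mu>])
qed

context
  fixes n :: nat and \<mu> :: "complex mat measure" and I :: "'a set" and r s :: "'a \<Rightarrow> nat"
  assumes \<mu>: "haar_unitary n \<mu>" and finI: "finite I"
    and r: "r ` I \<subseteq> {..<n}" and s: "s ` I \<subseteq> {..<n}"
begin

lemma measurable_moment_integrand:
  assumes "j ` I \<subseteq> {..<n}" "l ` I \<subseteq> {..<n}"
  shows "(\<lambda>U. \<Prod>i\<in>I. U $$ (r i, j i) * cnj (U $$ (s i, l i))) \<in> borel_measurable (borel_unitary n)"
  using assms r s
  by (intro borel_measurable_prod borel_measurable_times borel_measurable_cnj
      measurable_unitary_entry) auto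

lemma integrable_moment_integrand:
  assumes "j ` I \<subseteq> {..<n}" "l ` I \<subseteq> {..<n}"
  shows "integrable \<mu> (\<lambda>U. \<Prod>i\<in>I. U $$ (r i, j i) * cnj (U $$ (s i, l i)))"
proof (rule integrable_bounded_prod[OF \<mu>])
  fix i U assume i: "i \<in> I" and U: "U \<in> unitary_group n"
  show "cmod (U $$ (r i, j i) * cnj (U $$ (s i, l i))) \<le> 1"
    unfolding norm_mult complex_mod_cnj using assms r s i U
    by (intro mult_le_one unitary_entry_norm_le_1[of U n]) auto
qed (use assms r s in \<open>intro borel_measurable_times borel_measurable_cnj
      measurable_unitary_entry, auto\<close>)

lemma haar_moment_right_mult:
  assumes jl: "j ` I \<subseteq> {..<n}" "l ` I \<subseteq> {..<n}" and V: "V \<in> unitary_group n"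
  shows "haar_moment \<mu> I r s j l = (\<integral>U. (\<Prod>i\<in>I. (\<Sum>p<n. U $$ (r i, p) * V $$ (p, j i)) *
      cnj (\<Sum>p<n. U $$ (s i, p) * V $$ (p, l i))) \<partial>\<mu>)"
proof -
  have "(\<lambda>A. A * V) \<in> borel_unitary n \<rightarrow>\<^sub>M borel_unitary n"
    using V by (intro measurable_unitary_mult) auto
  from haar_integral_invariant[OF \<mu> haar_right_invariant[OF \<mu> V] this
      measurable_moment_integrand[OF jl]]
  have "haar_moment \<mu> I r s j l =
      (\<integral>U. (\<Prod>i\<in>I. (U * V) $$ (r i, j i) * cnj ((U * V) $$ (s i, l i))) \<partial>\<mu>)"
    by (simp add: haar_moment_def)
  also have "\<dots> = (\<integral>U. (\<Prod>i\<in>I. (\<Sum>p<n. U $$ (r i, p) * V $$ (p, j i)) *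
      cnj (\<Sum>p<n. U $$ (s i, p) * V $$ (p, l i))) \<partial>\<mu>)"
  proof (intro Bochner_Integration.integral_cong refl prod.cong)
    fix U i assume "U \<in> space \<mu>" and i: "i \<in> I"
    then have "U \<in> carrier_mat n n" using haar_space[OF \<mu>] unitary_group_carrier by blast
    note * = mult_mat_entry[OF this unitary_group_carrier[OF V]]
    have "r i < n" "s i < n" "j i < n" "l i < n" using i r s jl by auto
    then show "(U * V) $$ (r i, j i) * cnj ((U * V) $$ (s i, l i)) =
      (\<Sum>p<n. U $$ (r i, p) * V $$ (p, j i)) * cnj (\<Sum>p<n. U $$ (s i, p) * V $$ (p, l i))"
      by (simp add: *)
  qed
  finally show ?thesis .
qed

text \<open>
  Right translation by the unitary matrix with entry \<open>z d\<close> at position \<open>(p d, d)\<close> for each \<open>d\<close>. It covers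
  both diagonal matrices and permutation matrices.
\<close>

lemma haar_moment_monomial:
  assumes jl: "j ` I \<subseteq> {..<n}" "l ` I \<subseteq> {..<n}"
    and p: "p permutes {..<n}" and z: "\<And>c. c < n \<Longrightarrow> cmod (z c) = 1"
  shows "haar_moment \<mu> I r s j l =
    (\<Prod>i\<in>I. z (j i) * cnj (z (l i))) * haar_moment \<mu> I r s (p \<circ> j) (p \<circ> l)"
proof -
  define V where "V = mat n n (\<lambda>(c, d). if c = p d then z d else 0)"
  have pn: "p c < n \<longleftrightarrow> c < n" for c using permutes_in_image[OF p, of c] by simp
  have zz: "cnj (z c) * z c = 1" if "c < n" for c
    using z[OF that] by (simp add: mult.commute complex_norm_square[symmetric])
  have V: "V \<in> unitary_group n"
  proof (rule unitary_groupI)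
    fix c d assume cd: "c < n" "d < n"
    have "(\<Sum>q<n. cnj (V $$ (q, c)) * V $$ (q, d)) =
        (\<Sum>q<n. if q = p c then (if p c = p d then cnj (z c) * z d else 0) else 0)"
      using cd by (intro sum.cong) (auto simp: V_def)
    also have "\<dots> = (if c = d then 1 else 0)"
      using cd by (auto simp: pn zz inj_eq[OF permutes_inj[OF p]])
    finally show "(\<Sum>q<n. cnj (V $$ (q, c)) * V $$ (q, d)) = (if c = d then 1 else 0)" .
  qed (simp add: V_def)
  have col: "(\<Sum>q<n. U $$ (a, q) * V $$ (q, d)) = z d * U $$ (a, p d)" if "d < n" for U :: "complex mat" and a d
  proof -
    have "(\<Sum>q<n. U $$ (a, q) * V $$ (q, d)) = (\<Sum>q<n. if q = p d then z d * U $$ (a, p d) else 0)"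
      using that by (intro sum.cong) (auto simp: V_def)
    then show ?thesis using that by (simp add: pn)
  qed
  have "haar_moment \<mu> I r s j l = (\<integral>U. (\<Prod>i\<in>I. z (j i) * cnj (z (l i))) *
      (\<Prod>i\<in>I. U $$ (r i, p (j i)) * cnj (U $$ (s i, p (l i)))) \<partial>\<mu>)"
    unfolding haar_moment_right_mult[OF jl V] prod.distrib[symmetric]
  proof (intro Bochner_Integration.integral_cong refl prod.cong)
    fix U i assume "i \<in> I"
    then have "j i < n" "l i < n" using jl by auto
    then show "(\<Sum>q<n. U $$ (r i, q) * V $$ (q, j i)) * cnj (\<Sum>q<n. U $$ (s i, q) * V $$ (q, l i)) =
      z (j i) * cnj (z (l i)) * (U $$ (r i, p (j i)) * cnj (U $$ (s i, p (l i))))"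
      by (simp add: col)
  qed
  then show ?thesis by (simp add: haar_moment_def)
qed

text \<open>
  Multiplying column \<open>c\<close> by a phase \<open>z\<close> multiplies the moment by a power of \<open>z\<close> whose exponent is the
  difference of the two multiplicities. If it is not zero, some \<open>z\<close> makes that power \<open>-1\<close>.
\<close>

lemma haar_moment_nonzero_weights:
  assumes jl: "j ` I \<subseteq> {..<n}" "l ` I \<subseteq> {..<n}" and nz: "haar_moment \<mu> I r s j l \<noteq> 0"
    and c: "c < n"
  shows "card {i \<in> I. j i = c} = card {i \<in> I. l i = c}"
proof (rule ccontr)
  let ?p = "card {i \<in> I. j i = c}" and ?q = "card {i \<in> I. l i = c}"
  assume ne: "?p \<noteq> ?q"
  \<comment> \<open>the angle for which \<open>cis ((p - q) * \<theta>) = cis pi = -1\<close>, with \<open>p\<close> and \<open>q\<close> the two multiplicities\<close>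
  define \<theta> where "\<theta> = pi / (real ?p - real ?q)"
  define z where "z d = (if d = c then cis \<theta> else 1)" for d
  have "(\<Prod>i\<in>I. z (j i)) = cis \<theta> ^ ?p" "(\<Prod>i\<in>I. cnj (z (l i))) = cnj (cis \<theta>) ^ ?q"
    using finI by (simp_all add: z_def if_distrib[of cnj] prod.If_cases Int_def)
  then have "(\<Prod>i\<in>I. z (j i) * cnj (z (l i))) = cis (real ?p * \<theta>) * cis (- (real ?q * \<theta>))"
    by (simp only: prod.distrib cis_cnj Complex.DeMoivre mult_minus_right)
  also have "\<dots> = cis ((real ?p - real ?q) * \<theta>)" by (simp add: cis_mult algebra_simps)
  also have "\<dots> = -1" using ne by (simp add: \<theta>_def)
  finally have "haar_moment \<mu> I r s j l = - haar_moment \<mu> I r s j l"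
    using haar_moment_monomial[OF jl permutes_id, of z] by (simp add: z_def comp_def)
  with nz show False by simp
qed

end

section \<open>The Weingarten expansion\<close>

context
  fixes n :: nat and \<mu> :: "complex mat measure" and I :: "'a set" and r s :: "'a \<Rightarrow> nat"
  assumes \<mu>: "haar_unitary n \<mu>" and finI: "finite I"
    and r: "r ` I \<subseteq> {..<n}" and s: "s ` I \<subseteq> {..<n}"
begin

text \<open>
  Infinitesimal invariance under the rotations \<open>e\<^sub>a \<mapsto> e\<^sub>a + t e\<^sub>b\<close>, \<open>e\<^sub>b \<mapsto> e\<^sub>b - t e\<^sub>a\<close>: the generator acts as a
  derivation on the product. These maps are unitary up to the factor \<open>sqrt (1 + t\<^sup>2)\<close> on the columns
  \<open>a\<close> and \<open>b\<close>. For a vanishing moment the factor is harmless, so that the transformed moment is a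
  polynomial in \<open>t\<close> that vanishes identically.
\<close>

lemma haar_moment_infinitesimal:
  assumes jl: "j ` I \<subseteq> {..<n}" "l ` I \<subseteq> {..<n}" and ab: "a < n" "b < n" "a \<noteq> b"
    and zero: "haar_moment \<mu> I r s j l = 0"
  shows "(\<Sum>i\<in>I. if j i = a then haar_moment \<mu> I r s (j(i := b)) l
              else if j i = b then - haar_moment \<mu> I r s (j(i := a)) l else 0)
       + (\<Sum>i\<in>I. if l i = a then haar_moment \<mu> I r s j (l(i := b))
              else if l i = b then - haar_moment \<mu> I r s j (l(i := a)) else 0) = 0"
proof -
  \<comment> \<open>\<open>W\<close> lists all factors, plain ones on the left and conjugate ones on the right; \<open>DW\<close> is their
    derivative under the rotation\<close>
  define D :: "complex mat \<Rightarrow> nat \<Rightarrow> nat \<Rightarrow> complex" where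
    "D U x c = (if c = a then U $$ (x, b) else if c = b then - U $$ (x, a) else 0)" for U x c
  define W where "W k U = (case k of Inl i \<Rightarrow> U $$ (r i, j i) | Inr i \<Rightarrow> cnj (U $$ (s i, l i)))"
    for k :: "'a + 'a" and U :: "complex mat"
  define DW where "DW k U = (case k of Inl i \<Rightarrow> D U (r i) (j i) | Inr i \<Rightarrow> cnj (D U (s i) (l i)))"
    for k :: "'a + 'a" and U :: "complex mat"
  define C where "C S = (\<integral>U. (\<Prod>k\<in>I <+> I. if k \<in> S then DW k U else W k U) \<partial>\<mu>)" for S
  have finK: "finite (I <+> I)" using finI by simp
  have integrable: "integrable \<mu> (\<lambda>U. \<Prod>k\<in>I <+> I. if k \<in> S then DW k U else W k U)" for S
  proof (rule integrable_bounded_prod[OF \<mu>])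
    fix k assume k: "k \<in> I <+> I"
    have "r i < n" "s i < n" "j i < n" "l i < n" if "i \<in> I" for i
      using that r s jl by auto
    note * = this
    have D: "(\<lambda>U. D U x c) \<in> borel_measurable (borel_unitary n)" if "x < n" for x c
      using that ab by (cases "c = a"; cases "c = b")
        (auto simp: D_def intro!: measurable_unitary_entry borel_measurable_uminus)
    show "(\<lambda>U. if k \<in> S then DW k U else W k U) \<in> borel_measurable (borel_unitary n)"
      using k ab * by (cases k; cases "k \<in> S")
        (auto simp: DW_def W_def intro!: D measurable_unitary_entry borel_measurable_cnj)
    fix U assume "U \<in> unitary_group n"
    from unitary_entry_norm_le_1[OF this] show "cmod (if k \<in> S then DW k U else W k U) \<le> 1"
      using k ab * by (cases k) (auto simp: DW_def W_def D_def)
  qed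
  have rotated: "(\<integral>U. (\<Prod>k\<in>I <+> I. of_real t * DW k U + W k U) \<partial>\<mu>) = 0" for t :: real
  proof -
    define w where "w = sqrt (1 + t\<^sup>2)"
    have w: "w > 0" "w * w = 1 + t * t"
      by (simp_all add: w_def add_pos_nonneg power2_eq_square)
    define q where "q c = (if c = a \<or> c = b then 1 / w else 1)" for c :: nat
    define A :: "nat \<Rightarrow> nat \<Rightarrow> complex" where
      "A x c = (if c = a \<and> x = b then 1 else if c = b \<and> x = a then -1 else 0)" for x c
    define V where "V = mat n n (\<lambda>(x, c). of_real (q c) * ((if x = c then 1 else 0) + of_real t * A x c))"
    have entry: "V $$ (x, c) = of_real (q c) * ((if x = c then 1 else 0) + of_real t * A x c)"
      if "x < n" "c < n" for x c using that by (simp add: V_def)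
    \<comment> \<open>a row vector \<open>f\<close> times the unnormalized matrix \<open>1 + t A\<close>\<close>
    have sumA: "(\<Sum>x<n. f x * ((if x = c then 1 else 0) + of_real t * A x c)) =
        f c + of_real t * (if c = a then f b else if c = b then - f a else 0)"
      if "c < n" for f c
    proof -
      have "(\<Sum>x<n. f x * ((if x = c then 1 else 0) + of_real t * A x c)) =
        (\<Sum>x<n. (if x = c then f c else 0) + (if x = b then (if c = a then of_real t * f b else 0) else 0)
          + (if x = a then (if c = b then - of_real t * f a else 0) else 0))"
        using ab by (intro sum.cong) (auto simp: A_def algebra_simps)
      then show ?thesis using that ab by (simp add: sum.distrib)
    qed
    have V: "V \<in> unitary_group n"
    proof (rule unitary_groupI)
      fix c d assume cd: "c < n" "d < n"
      have "(\<Sum>x<n. cnj (V $$ (x, c)) * V $$ (x, d)) = of_real (q d) *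
         (\<Sum>x<n. cnj (V $$ (x, c)) * ((if x = d then 1 else 0) + of_real t * A x d))"
        using cd by (simp add: entry[of _ d] sum_distrib_left mult_ac)
      also have "\<dots> = of_real (q d) * (cnj (V $$ (d, c)) + of_real t *
          (if d = a then cnj (V $$ (b, c)) else if d = b then - cnj (V $$ (a, c)) else 0))"
        using cd by (subst sumA) auto
      also have "\<dots> = (if c = d then 1 else 0)"
      proof -
        have *: "complex_of_real w * complex_of_real w = 1 + of_real t * of_real t"
          by (metis w(2) of_real_1 of_real_add of_real_mult)
        then have nz: "1 + complex_of_real t * of_real t \<noteq> 0"
          using w(1) by (metis mult_eq_0_iff of_real_eq_0_iff less_irrefl)
        show ?thesis
          using cd ab w(1) * nz
          by (auto simp: entry q_def A_def field_simps simp flip: add_divide_distrib)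
      qed
      finally show "(\<Sum>x<n. cnj (V $$ (x, c)) * V $$ (x, d)) = (if c = d then 1 else 0)" .
    qed (simp add: V_def)
    have col: "(\<Sum>x<n. U $$ (y, x) * V $$ (x, c)) = of_real (q c) * (of_real t * D U y c + U $$ (y, c))"
      if "c < n" for U y c
    proof -
      have "(\<Sum>x<n. U $$ (y, x) * V $$ (x, c)) =
        of_real (q c) * (\<Sum>x<n. U $$ (y, x) * ((if x = c then 1 else 0) + of_real t * A x c))"
        using that by (simp add: entry sum_distrib_left mult_ac)
      then show ?thesis using that by (simp add: sumA D_def)
    qed
    let ?q = "\<Prod>i\<in>I. complex_of_real (q (j i)) * complex_of_real (q (l i))"
    have "0 = (\<integral>U. ?q * (\<Prod>k\<in>I <+> I. of_real t * DW k U + W k U) \<partial>\<mu>)"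
      unfolding zero[symmetric] haar_moment_right_mult[OF \<mu> finI r s jl V]
    proof (intro Bochner_Integration.integral_cong refl)
      fix U :: "complex mat"
      have "(\<Prod>k\<in>I <+> I. of_real t * DW k U + W k U) =
        (\<Prod>i\<in>I. (of_real t * D U (r i) (j i) + U $$ (r i, j i)) *
           cnj (of_real t * D U (s i) (l i) + U $$ (s i, l i)))"
        using finI by (simp add: prod.Plus comp_def DW_def W_def prod.distrib)
      then have "?q * (\<Prod>k\<in>I <+> I. of_real t * DW k U + W k U) = (\<Prod>i\<in>I.
         of_real (q (j i)) * of_real (q (l i)) * ((of_real t * D U (r i) (j i) + U $$ (r i, j i)) *
           cnj (of_real t * D U (s i) (l i) + U $$ (s i, l i))))"
        by (simp add: prod.distrib)
      also have "\<dots> = (\<Prod>i\<in>I. (\<Sum>p<n. U $$ (r i, p) * V $$ (p, j i)) *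
        cnj (\<Sum>p<n. U $$ (s i, p) * V $$ (p, l i)))"
      proof (rule prod.cong)
        fix i assume "i \<in> I"
        then have "j i < n" "l i < n" using jl by auto
        from col[OF this(1)] col[OF this(2)]
        show "of_real (q (j i)) * of_real (q (l i)) * ((of_real t * D U (r i) (j i) + U $$ (r i, j i)) *
           cnj (of_real t * D U (s i) (l i) + U $$ (s i, l i))) =
           (\<Sum>p<n. U $$ (r i, p) * V $$ (p, j i)) * cnj (\<Sum>p<n. U $$ (s i, p) * V $$ (p, l i))"
          by simp
      qed simp
      finally show "(\<Prod>i\<in>I. (\<Sum>p<n. U $$ (r i, p) * V $$ (p, j i)) *
        cnj (\<Sum>p<n. U $$ (s i, p) * V $$ (p, l i))) =
        ?q * (\<Prod>k\<in>I <+> I. of_real t * DW k U + W k U)" ..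
    qed
    moreover have "?q \<noteq> 0" using w(1) finI by (auto simp: q_def)
    ultimately show ?thesis by simp
  qed
  have "(\<Sum>S\<in>Pow (I <+> I). of_real t ^ card S * C S) = 0" for t :: real
  proof -
    have "0 = (\<integral>U. (\<Sum>S\<in>Pow (I <+> I). of_real t ^ card S *
        (\<Prod>k\<in>I <+> I. if k \<in> S then DW k U else W k U)) \<partial>\<mu>)"
      unfolding rotated[of t, symmetric]
    proof (intro Bochner_Integration.integral_cong refl)
      fix U
      have "(\<Prod>k\<in>S. of_real t * DW k U) * (\<Prod>k\<in>I <+> I - S. W k U) =
        of_real t ^ card S * (\<Prod>k\<in>I <+> I. if k \<in> S then DW k U else W k U)"
        if "S \<in> Pow (I <+> I)" for S
      proof -
        have "(I <+> I) \<inter> S = S" "(I <+> I) \<inter> - S = I <+> I - S" using that by auto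
        then show ?thesis using finK by (simp add: prod.distrib prod.If_cases mult_ac)
      qed
      then show "(\<Prod>k\<in>I <+> I. of_real t * DW k U + W k U) = (\<Sum>S\<in>Pow (I <+> I). of_real t ^ card S *
          (\<Prod>k\<in>I <+> I. if k \<in> S then DW k U else W k U))"
        unfolding prod_add[OF finK] by (intro sum.cong) auto
    qed
    also have "\<dots> = (\<Sum>S\<in>Pow (I <+> I). of_real t ^ card S * C S)"
      unfolding C_def using integrable by (subst Bochner_Integration.integral_sum) auto
    finally show ?thesis by simp
  qed
  from poly_vanishing_linear_coeff[OF finK this]
  have *: "(\<Sum>i\<in>I. C {Inl i}) + (\<Sum>i\<in>I. C {Inr i}) = 0"
    using finI by (simp add: sum.Plus)
  have split: "C S = (\<integral>U. (\<Prod>i\<in>I. (if Inl i \<in> S then D U (r i) (j i) else U $$ (r i, j i)) *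
      cnj (if Inr i \<in> S then D U (s i) (l i) else U $$ (s i, l i))) \<partial>\<mu>)" for S
  proof -
    have [simp]: "cnj (if P then x else y) = (if P then cnj x else cnj y)" for P x y by simp
    show ?thesis
      unfolding C_def using finI by (simp add: prod.Plus comp_def DW_def W_def prod.distrib cong: if_cong)
  qed
  have neg: "(\<integral>U. (\<Prod>i'\<in>I. f U i') \<partial>\<mu>) = - (\<integral>U. (\<Prod>i'\<in>I. g U i') \<partial>\<mu>)"
    if "i \<in> I" "\<And>U. f U i = - g U i" "\<And>U i'. i' \<noteq> i \<Longrightarrow> f U i' = g U i'"
    for f g :: "complex mat \<Rightarrow> 'a \<Rightarrow> complex" and i
  proof -
    have "(\<Prod>i'\<in>I. f U i') = - (\<Prod>i'\<in>I. g U i')" for U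
    proof -
      have "(\<Prod>i'\<in>I - {i}. f U i') = (\<Prod>i'\<in>I - {i}. g U i')"
        using that(3) by (intro prod.cong) auto
      then show ?thesis using that(1,2) finI by (simp add: prod.remove[of I i])
    qed
    then show ?thesis by simp
  qed
  have vanish: "(\<integral>U. (\<Prod>i'\<in>I. f U i') \<partial>\<mu>) = 0" if "i \<in> I" "\<And>U. f U i = 0"
    for f :: "complex mat \<Rightarrow> 'a \<Rightarrow> complex" and i
  proof -
    have "(\<Prod>i'\<in>I. f U i') = 0" for U using that finI by (intro prod_zero) auto
    then show ?thesis by simp
  qed
  have "C {Inl i} = (if j i = a then haar_moment \<mu> I r s (j(i := b)) l
              else if j i = b then - haar_moment \<mu> I r s (j(i := a)) l else 0)" if "i \<in> I" for i
  proof -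
    consider "j i = a" | "j i = b" "j i \<noteq> a" | "j i \<noteq> a" "j i \<noteq> b" by blast
    then show ?thesis
    proof cases
      case 1
      then show ?thesis unfolding split haar_moment_def
        by (auto simp: D_def intro!: Bochner_Integration.integral_cong prod.cong)
    next
      case 2
      have "C {Inl i} = - haar_moment \<mu> I r s (j(i := a)) l"
        unfolding split haar_moment_def
        using that 2 by (intro neg[of i]) (auto simp: D_def)
      then show ?thesis using 2 by simp
    next
      case 3
      have "C {Inl i} = 0" unfolding split
        using that 3 by (intro vanish[of i]) (auto simp: D_def)
      then show ?thesis using 3 by simp
    qed
  qed
  moreover have "C {Inr i} = (if l i = a then haar_moment \<mu> I r s j (l(i := b))
              else if l i = b then - haar_moment \<mu> I r s j (l(i := a)) else 0)" if "i \<in> I" for i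
  proof -
    consider "l i = a" | "l i = b" "l i \<noteq> a" | "l i \<noteq> a" "l i \<noteq> b" by blast
    then show ?thesis
    proof cases
      case 1
      then show ?thesis unfolding split haar_moment_def
        by (auto simp: D_def intro!: Bochner_Integration.integral_cong prod.cong)
    next
      case 2
      have "C {Inr i} = - haar_moment \<mu> I r s j (l(i := a))"
        unfolding split haar_moment_def
        using that 2 by (intro neg[of i]) (auto simp: D_def)
      then show ?thesis using 2 by simp
    next
      case 3
      have "C {Inr i} = 0" unfolding split
        using that 3 by (intro vanish[of i]) (auto simp: D_def)
      then show ?thesis using 3 by simp
    qed
  qed
  ultimately show ?thesis using * by simp
qed

text \<open>
  Apply \<open>haar_moment_infinitesimal\<close> after moving the occurrence \<open>p\<close> of the column \<open>j p\<close> to the unused column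
  \<open>a\<close>. Rotating the plain factors back gives the moment of \<open>j\<close>, or terms with \<open>a\<close> occurring twice, which
  vanish because \<open>a\<close> does not occur in \<open>l\<close>. Rotating the conjugate factors gives the sum.
\<close>

lemma haar_moment_split_column:
  assumes jl: "j ` I \<subseteq> {..<n}" "l ` I \<subseteq> {..<n}"
    and p: "p \<in> I" and a: "a < n" "a \<notin> j ` I" "a \<notin> l ` I"
  shows "haar_moment \<mu> I r s j l =
    (\<Sum>q | q \<in> I \<and> l q = j p. haar_moment \<mu> I r s (j(p := a)) (l(q := a)))"
proof -
  let ?j = "j(p := a)" and ?b = "j p"
  have j': "?j ` I \<subseteq> {..<n}" using jl(1) a(1) by auto
  have zero: "haar_moment \<mu> I r s J l = 0" if J: "J ` I \<subseteq> {..<n}" and "i \<in> I" "J i = a" for J i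
  proof (rule ccontr)
    assume "haar_moment \<mu> I r s J l \<noteq> 0"
    from haar_moment_nonzero_weights[OF \<mu> finI r s J jl(2) this a(1)]
    have "card {i \<in> I. J i = a} = card {i \<in> I. l i = a}" .
    also have "{i \<in> I. l i = a} = {}" using a(3) by auto
    finally have "{i \<in> I. J i = a} = {}" using finI by simp
    then show False using that by blast
  qed
  have b: "?b < n" "a \<noteq> ?b" using p jl(1) a(2) by auto
  have "(\<Sum>i\<in>I. if ?j i = a then haar_moment \<mu> I r s (?j(i := ?b)) l
              else if ?j i = ?b then - haar_moment \<mu> I r s (?j(i := a)) l else 0)
      = (\<Sum>i\<in>I. if i = p then haar_moment \<mu> I r s j l else 0)"
  proof (rule sum.cong)
    fix i assume i: "i \<in> I"
    have "haar_moment \<mu> I r s (?j(i := a)) l = 0"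
      using j' a(1) by (intro zero[OF _ i]) auto
    moreover have "?j i = a \<longleftrightarrow> i = p" using i a(2) by auto
    ultimately show "(if ?j i = a then haar_moment \<mu> I r s (?j(i := ?b)) l
              else if ?j i = ?b then - haar_moment \<mu> I r s (?j(i := a)) l else 0) =
       (if i = p then haar_moment \<mu> I r s j l else 0)" by simp
  qed simp
  also have "\<dots> = haar_moment \<mu> I r s j l" using p finI by simp
  finally have 1: "(\<Sum>i\<in>I. if ?j i = a then haar_moment \<mu> I r s (?j(i := ?b)) l
              else if ?j i = ?b then - haar_moment \<mu> I r s (?j(i := a)) l else 0)
      = haar_moment \<mu> I r s j l" .
  have "(\<Sum>i\<in>I. if l i = a then haar_moment \<mu> I r s ?j (l(i := ?b))
              else if l i = ?b then - haar_moment \<mu> I r s ?j (l(i := a)) else 0)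
     = (\<Sum>i\<in>I. if l i = ?b then - haar_moment \<mu> I r s ?j (l(i := a)) else 0)"
    using a(3) by (intro sum.cong) auto
  also have "\<dots> = - (\<Sum>q | q \<in> I \<and> l q = ?b. haar_moment \<mu> I r s ?j (l(q := a)))"
    unfolding sum_negf[symmetric] using finI by (intro sum.mono_neutral_cong_right) auto
  finally have 2: "(\<Sum>i\<in>I. if l i = a then haar_moment \<mu> I r s ?j (l(i := ?b))
              else if l i = ?b then - haar_moment \<mu> I r s ?j (l(i := a)) else 0)
     = - (\<Sum>q | q \<in> I \<and> l q = ?b. haar_moment \<mu> I r s ?j (l(q := a)))" .
  have "haar_moment \<mu> I r s ?j l = 0" using j' p by (intro zero[of _ p]) auto
  from haar_moment_infinitesimal[OF j' jl(2) a(1) b this] show ?thesis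
    unfolding 1 2 by simp
qed

text \<open>
  The Weingarten formula in the stable range \<open>card I \<le> n\<close>, by induction on the number of repetitions
  among the columns \<open>j\<close>. As long as there is one, some column \<open>a\<close> is unused, and
  \<open>haar_moment_split_column\<close> reduces the number. The permutations counted for \<open>j\<close> and \<open>l\<close> are
  distributed over the summands according to the preimage \<open>q\<close> of the moved position \<open>p\<close>. If \<open>j\<close> is
  injective, the weights leave at most one \<open>\<sigma>\<close>, and a permutation matrix carries \<open>e\<close> to \<open>j\<close>.
\<close>

theorem haar_moment_expansion:
  assumes card: "card I \<le> n" and e: "inj_on e I" "e ` I \<subseteq> {..<n}"
    and jl: "j ` I \<subseteq> {..<n}" "l ` I \<subseteq> {..<n}"
  shows "haar_moment \<mu> I r s j l =
    (\<Sum>\<sigma> | \<sigma> permutes I \<and> (\<forall>i\<in>I. l i = j (\<sigma> i)). haar_moment \<mu> I r s e (e \<circ> \<sigma>))"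
  using jl
proof (induction "card I - card (j ` I)" arbitrary: j l rule: less_induct)
  case less
  note j = less.prems(1) and l = less.prems(2)
  let ?S = "\<lambda>j l. {\<sigma>. \<sigma> permutes I \<and> (\<forall>i\<in>I. l i = j (\<sigma> i))}"
  have finS: "finite (?S j l)" for j l :: "'a \<Rightarrow> nat"
    using finite_permutations[OF finI] by simp
  show ?case
  proof (cases "inj_on j I")
    case inj: True
    show ?thesis
    proof (cases "?S j l = {}")
      case False
      then obtain \<sigma> where \<sigma>: "\<sigma> permutes I" "\<And>i. i \<in> I \<Longrightarrow> l i = j (\<sigma> i)" by blast
      have S: "?S j l = {\<sigma>}"
      proof (intro equalityI subsetI; clarsimp)
        fix \<tau> assume \<tau>: "\<tau> permutes I" "\<forall>i\<in>I. l i = j (\<tau> i)"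
        show "\<tau> = \<sigma>"
        proof
          fix i show "\<tau> i = \<sigma> i"
          proof (cases "i \<in> I")
            case True
            then show ?thesis
              using inj_onD[OF inj] \<sigma> \<tau> by (metis permutes_in_image)
          qed (use \<sigma> \<tau> in \<open>simp add: permutes_not_in\<close>)
        qed
      qed (use \<sigma> in auto)
      obtain p where p: "p permutes {..<n}" "\<And>i. i \<in> I \<Longrightarrow> p (e i) = j i"
        using permutes_extending_injections[OF finI e inj j] by blast
      have e\<sigma>: "(e \<circ> \<sigma>) ` I \<subseteq> {..<n}"
        using e(2) by (auto simp: permutes_in_image[OF \<sigma>(1)] image_subset_iff)
      have "haar_moment \<mu> I r s e (e \<circ> \<sigma>) = haar_moment \<mu> I r s (p \<circ> e) (p \<circ> (e \<circ> \<sigma>))"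
        using haar_moment_monomial[OF \<mu> finI r s e(2) e\<sigma> p(1), of "\<lambda>_. 1"] by simp
      also have "\<dots> = haar_moment \<mu> I r s j l"
        using p(2) \<sigma> by (intro haar_moment_cong) (auto simp: permutes_in_image)
      finally show ?thesis unfolding S by simp
    next
      case True
      have "haar_moment \<mu> I r s j l = 0"
      proof (rule ccontr)
        assume "haar_moment \<mu> I r s j l \<noteq> 0"
        note w = haar_moment_nonzero_weights[OF \<mu> finI r s j l this]
        have img: "i \<in> I \<Longrightarrow> l i \<in> j ` I" for i
        proof -
          assume i: "i \<in> I"
          then have "card {i' \<in> I. l i' = l i} > 0" using finI by (auto simp: card_gt_0_iff)
          then have "card {i' \<in> I. j i' = l i} > 0" using w[of "l i"] l i by auto
          then obtain x where "x \<in> I" "j x = l i" by (auto simp: card_gt_0_iff)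
          then show "l i \<in> j ` I" by (metis imageI)
        qed
        have "inj_on l I"
        proof (rule inj_onI)
          fix x y assume xy: "x \<in> I" "y \<in> I" "l x = l y"
          have "card {i \<in> I. j i = l x} \<le> 1"
            using finI by (auto simp: card_le_Suc0_iff_eq intro: inj_onD[OF inj])
          then have "card {i \<in> I. l i = l x} \<le> 1" using w[of "l x"] l xy by auto
          then show "x = y" using xy finI by (auto simp: card_le_Suc0_iff_eq)
        qed
        define \<sigma> where "\<sigma> i = (if i \<in> I then inv_into I j (l i) else i)" for i
        have \<sigma>: "i \<in> I \<Longrightarrow> \<sigma> i \<in> I \<and> j (\<sigma> i) = l i" for i
          using img[of i] by (simp add: \<sigma>_def inv_into_into f_inv_into_f)
        have "inj_on \<sigma> I"
          using \<sigma> \<open>inj_on l I\<close> by (metis (no_types, lifting) inj_on_def)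
        then have "bij_betw \<sigma> I I"
          using \<sigma> finI by (metis (no_types, lifting) bij_betw_def endo_inj_surj image_subsetI)
        then have "\<sigma> permutes I" by (rule bij_imp_permutes) (simp add: \<sigma>_def)
        then have "\<sigma> \<in> ?S j l" using \<sigma> by auto
        with True show False by blast
      qed
      then show ?thesis using True by (metis (no_types, lifting) sum.empty)
    qed
  next
    case False
    then obtain p p' where p: "p \<in> I" "p' \<in> I" "p \<noteq> p'" "j p = j p'"
      by (auto simp: inj_on_def)
    have "card (j ` I) < card I"
      using False card_image_le[OF finI] eq_card_imp_inj_on[OF finI] by (metis le_neq_implies_less)
    then have lt: "card (j ` I) < card {..<n}" using card by simp
    then obtain a where a: "a < n" "a \<notin> j ` I"
      by (metis card_mono finite_imageI finI lessThan_iff linorder_not_less subsetI)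
    show ?thesis
    proof (cases "a \<in> l ` I")
      case True
      then have S: "?S j l = {}" using a(2) by (force simp: permutes_in_image)
      have "haar_moment \<mu> I r s j l = 0"
      proof (rule ccontr)
        assume "haar_moment \<mu> I r s j l \<noteq> 0"
        from haar_moment_nonzero_weights[OF \<mu> finI r s j l this a(1)]
        have "card {i \<in> I. l i = a} = card {i \<in> I. j i = a}" ..
        also have "{i \<in> I. j i = a} = {}" using a(2) by auto
        finally have "{i \<in> I. l i = a} = {}" using finI by simp
        then show False using True by blast
      qed
      then show ?thesis using S by (metis (no_types, lifting) sum.empty)
    next
      case al: False
      let ?j = "j(p := a)" and ?Q = "{q. q \<in> I \<and> l q = j p}"
      have "?j ` I = insert a (j ` I)"
      proof (intro equalityI subsetI)
        fix x assume "x \<in> insert a (j ` I)"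
        then consider "x = a" | i where "i \<in> I" "x = j i" "i \<noteq> p" | "x = j p'"
          using p(4) by auto
        then show "x \<in> ?j ` I"
        proof cases
          case 1 then show ?thesis using p(1) by (intro image_eqI[of _ _ p]) auto
        next
          case 2 then show ?thesis by (intro image_eqI[of _ _ i]) auto
        next
          case 3 then show ?thesis using p by (intro image_eqI[of _ _ p']) auto
        qed
      qed auto
      then have "card (?j ` I) = Suc (card (j ` I))" using a(2) finI by simp
      then have dec: "card I - card (?j ` I) < card I - card (j ` I)"
        using \<open>card (j ` I) < card I\<close> by simp
      have j': "?j ` I \<subseteq> {..<n}" using j a(1) by auto
      have l': "(l(q := a)) ` I \<subseteq> {..<n}" for q using l a(1) by auto
      have S: "?S j l = (\<Union>q\<in>?Q. ?S ?j (l(q := a)))"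
      proof (intro equalityI subsetI)
        fix \<sigma> assume \<sigma>: "\<sigma> \<in> ?S j l"
        then have perm: "\<sigma> permutes I" by simp
        from p(1) permutes_image[OF perm] have "p \<in> \<sigma> ` I" by simp
        then obtain q where q: "q \<in> I" "\<sigma> q = p" by (elim imageE) simp
        have l\<sigma>: "l i = j (\<sigma> i)" if "i \<in> I" for i using \<sigma> that by blast
        have "(l(q := a)) i = ?j (\<sigma> i)" if "i \<in> I" for i
        proof (cases "i = q")
          case False
          then have "\<sigma> i \<noteq> p" unfolding q(2)[symmetric] inj_eq[OF permutes_inj[OF perm]] .
          then show ?thesis using l\<sigma>[OF that] False by simp
        qed (simp add: q(2))
        then have "\<sigma> \<in> ?S ?j (l(q := a))" by (intro CollectI conjI ballI perm)
        moreover have "q \<in> ?Q" using l\<sigma>[OF q(1)] q by simp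
        ultimately show "\<sigma> \<in> (\<Union>q\<in>?Q. ?S ?j (l(q := a)))" by (rule UN_I[rotated])
      next
        fix \<sigma> assume "\<sigma> \<in> (\<Union>q\<in>?Q. ?S ?j (l(q := a)))"
        then obtain q where Q: "q \<in> ?Q" and mem: "\<sigma> \<in> ?S ?j (l(q := a))" by (rule UN_E)
        from Q have q: "q \<in> I" "l q = j p" by simp_all
        note mem' = CollectD[OF mem]
        note perm = conjunct1[OF mem'] and * = bspec[OF conjunct2[OF mem']]
        have "a = ?j (\<sigma> q)" using *[OF q(1)] by simp
        moreover have "\<sigma> q \<in> I" using permutes_in_image[OF perm] q(1) by simp
        ultimately have \<sigma>q: "\<sigma> q = p" using a(2) by (cases "\<sigma> q = p") auto
        have "l i = j (\<sigma> i)" if "i \<in> I" for i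
        proof (cases "i = q")
          case False
          then have "\<sigma> i \<noteq> p" unfolding \<sigma>q[symmetric] inj_eq[OF permutes_inj[OF perm]] .
          then show ?thesis using *[OF that] False by simp
        qed (use \<sigma>q q in simp)
        then show "\<sigma> \<in> ?S j l" by (intro CollectI conjI ballI perm)
      qed
      have disj: "?S ?j (l(q := a)) \<inter> ?S ?j (l(q' := a)) = {}" if "q \<in> ?Q" "q' \<in> ?Q" "q \<noteq> q'" for q q'
      proof (rule ccontr)
        assume "\<not> ?thesis"
        then obtain \<sigma> where "\<sigma> \<in> ?S ?j (l(q := a))" "\<sigma> \<in> ?S ?j (l(q' := a))"
          unfolding ex_in_conv[symmetric] by (elim exE IntE)
        note mem = CollectD[OF this(1)] CollectD[OF this(2)]
        note perm = conjunct1[OF mem(1)]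
          and 1 = bspec[OF conjunct2[OF mem(1)]] and 2 = bspec[OF conjunct2[OF mem(2)]]
        have "\<sigma> q \<in> I" "\<sigma> q' \<in> I" using permutes_in_image[OF perm] that by simp_all
        moreover have "a = ?j (\<sigma> q)" "a = ?j (\<sigma> q')" using 1[of q] 2[of q'] that by simp_all
        ultimately have "\<sigma> q = p" "\<sigma> q' = p"
          using a(2) by (cases "\<sigma> q = p"; cases "\<sigma> q' = p"; auto)+
        then show False using that(3) inj_eq[OF permutes_inj[OF perm], of q q'] by simp
      qed
      have "haar_moment \<mu> I r s j l =
          (\<Sum>q\<in>?Q. haar_moment \<mu> I r s ?j (l(q := a)))"
        by (rule haar_moment_split_column[OF j l p(1) a al])
      also have "\<dots> = (\<Sum>q\<in>?Q. \<Sum>\<sigma>\<in>?S ?j (l(q := a)). haar_moment \<mu> I r s e (e \<circ> \<sigma>))"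
        by (intro sum.cong refl less.hyps[OF dec j' l'])
      also have "\<dots> = (\<Sum>\<sigma>\<in>?S j l. haar_moment \<mu> I r s e (e \<circ> \<sigma>))"
        unfolding S by (intro sum.UNION_disjoint[symmetric] ballI impI finS disj) (use finI in simp)
      finally show ?thesis .
    qed
  qed
qed

end

section \<open>Moments of a single row\<close>

text \<open>
  Insert the factor \<open>1 = \<Sum>\<^sub>b \<bar>u\<^sub>x\<^sub>b\<bar>\<^sup>2\<close>, recorded at a fresh index \<open>a\<close>.
\<close>

lemma haar_row_normalized:
  assumes \<mu>: "haar_unitary n \<mu>" and finI: "finite I"
    and r: "r ` I \<subseteq> {..<n}" and s: "s ` I \<subseteq> {..<n}"
    and jl: "j ` I \<subseteq> {..<n}" "l ` I \<subseteq> {..<n}" and x: "x < n" and a: "a \<notin> I"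
  shows "haar_moment \<mu> I r s j l =
    (\<Sum>b<n. haar_moment \<mu> (insert a I) (r(a := x)) (s(a := x)) (j(a := b)) (l(a := b)))"
proof -
  let ?g = "\<lambda>b U. \<Prod>i\<in>insert a I. U $$ ((r(a := x)) i, (j(a := b)) i) *
      cnj (U $$ ((s(a := x)) i, (l(a := b)) i))"
  have rest: "?g b U = U $$ (x, b) * cnj (U $$ (x, b)) *
      (\<Prod>i\<in>I. U $$ (r i, j i) * cnj (U $$ (s i, l i)))" for b U
  proof -
    have "(\<Prod>i\<in>I. U $$ ((r(a := x)) i, (j(a := b)) i) * cnj (U $$ ((s(a := x)) i, (l(a := b)) i)))
      = (\<Prod>i\<in>I. U $$ (r i, j i) * cnj (U $$ (s i, l i)))"
      using a by (intro prod.cong) auto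
    then show ?thesis using finI a by simp
  qed
  have "haar_moment \<mu> I r s j l = (\<integral>U. (\<Sum>b<n. ?g b U) \<partial>\<mu>)"
    unfolding haar_moment_def rest sum_distrib_right[symmetric]
    by (intro Bochner_Integration.integral_cong refl)
      (simp add: haar_space[OF \<mu>] unitary_rows_orthonormal[OF _ x x])
  also have "\<dots> = (\<Sum>b<n. \<integral>U. ?g b U \<partial>\<mu>)"
  proof (rule Bochner_Integration.integral_sum)
    fix b assume "b \<in> {..<n}"
    then show "integrable \<mu> (?g b)"
      using finI r s jl x by (intro integrable_moment_integrand[OF \<mu>]) auto
  qed
  finally show ?thesis by (simp add: haar_moment_def)
qed

text \<open>
  Add points to \<open>S\<close> one at a time. By \<open>haar_row_normalized\<close> the moment of \<open>S\<close> is the sum over \<open>b\<close> of the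
  moments with an additional factor \<open>\<bar>u\<^sub>x\<^sub>b\<bar>\<^sup>2\<close>. All of them are multiples of the moment of
  \<open>insert a S\<close>, by \<open>2\<close> for \<open>b \<in> S\<close> and by \<open>1\<close> otherwise, in total by \<open>n + card S\<close>, which is the next factor of
  the rising factorial.
\<close>

theorem haar_row_moment:
  assumes \<mu>: "haar_unitary n \<mu>" and x: "x < n" and S: "S \<subseteq> {..<n}"
  shows "haar_moment \<mu> S (\<lambda>_. x) (\<lambda>_. x) (\<lambda>c. c) (\<lambda>c. c) = 1 / pochhammer (of_nat n) (card S)"
proof -
  have "finite S" using S finite_subset by blast
  then show ?thesis using S
  proof (induction S rule: finite_induct)
    case empty
    interpret prob_space \<mu> using \<mu> by (simp add: haar_unitary_def)
    show ?case by (simp add: haar_moment_def prob_space)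
  next
    case (insert a S)
    let ?T = "insert a S" and ?c = "\<lambda>_. x"
    let ?m = "haar_moment \<mu> ?T ?c ?c (\<lambda>c. c) (\<lambda>c. c)"
    have T: "finite ?T" "(\<lambda>c. c) ` ?T \<subseteq> {..<n}" "card ?T \<le> n" "?c ` ?T \<subseteq> {..<n}"
      using insert x card_mono[of "{..<n}" ?T] by auto
    have perm: "haar_moment \<mu> ?T ?c ?c (\<lambda>c. c) ((\<lambda>c. c) \<circ> \<sigma>) = ?m" if "\<sigma> permutes ?T" for \<sigma>
    proof -
      have "(\<Prod>i\<in>?T. cnj (U $$ (x, \<sigma> i))) = (\<Prod>i\<in>?T. cnj (U $$ (x, i)))" for U
        using prod.permute[OF that, of "\<lambda>i. cnj (U $$ (x, i))"] by (simp add: comp_def)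
      then show ?thesis unfolding haar_moment_def by (simp only: prod.distrib comp_def)
    qed
    have merged: "haar_moment \<mu> ?T ?c ?c ((\<lambda>c. c)(a := b)) ((\<lambda>c. c)(a := b)) = (if b \<in> S then 2 else 1) * ?m"
      if "b < n" for b
    proof -
      have b: "((\<lambda>c. c)(a := b)) ` ?T \<subseteq> {..<n}" using that insert.prems by auto
      have "haar_moment \<mu> ?T ?c ?c ((\<lambda>c. c)(a := b)) ((\<lambda>c. c)(a := b)) =
        (\<Sum>\<sigma> | \<sigma> permutes ?T \<and> (\<forall>i\<in>?T. ((\<lambda>c. c)(a := b)) i = ((\<lambda>c. c)(a := b)) (\<sigma> i)).
          haar_moment \<mu> ?T ?c ?c (\<lambda>c. c) ((\<lambda>c. c) \<circ> \<sigma>))"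
        by (rule haar_moment_expansion[OF \<mu> T(1) T(4) T(4) T(3) inj_on_id2 T(2) b b])
      also have "\<dots> = (\<Sum>\<sigma> | \<sigma> permutes ?T \<and> (\<forall>i\<in>?T. ((\<lambda>c. c)(a := b)) i = ((\<lambda>c. c)(a := b)) (\<sigma> i)). ?m)"
        by (intro sum.cong refl perm; elim CollectE conjE)
      also have "\<dots> = of_nat (if b \<in> S then 2 else 1) * ?m"
        unfolding sum_constant card_stabilizer_merged_point[OF insert.hyps] ..
      finally show ?thesis by simp
    qed
    have S: "S \<subseteq> {..<n}" using insert.prems by auto
    have "haar_moment \<mu> S ?c ?c (\<lambda>c. c) (\<lambda>c. c) =
        (\<Sum>b<n. haar_moment \<mu> ?T (?c(a := x)) (?c(a := x)) ((\<lambda>c. c)(a := b)) ((\<lambda>c. c)(a := b)))"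
      using insert S x by (intro haar_row_normalized[OF \<mu>]) auto
    also have "\<dots> = (\<Sum>b<n. (if b \<in> S then 2 else 1) * ?m)"
      by (intro sum.cong refl) (simp add: merged fun_upd_idem)
    also have "\<dots> = (\<Sum>b<n. 1 + (if b \<in> S then 1 else 0)) * ?m"
      unfolding sum_distrib_right by (intro sum.cong) auto
    also have "(\<Sum>b<n. 1 + (if b \<in> S then 1 else 0 :: complex)) = of_nat n + of_nat (card S)"
      using S by (simp add: sum.distrib sum.If_cases Int_absorb1)
    finally have "1 / pochhammer (of_nat n) (card S) = (of_nat n + of_nat (card S)) * ?m"
      using insert.IH[OF S] by simp
    moreover have "of_nat (n + card S) \<noteq> (0::complex)" unfolding of_nat_eq_0_iff using x by simp
    ultimately have "?m = 1 / pochhammer (of_nat n) (card S) / (of_nat n + of_nat (card S))"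
      by (simp add: nonzero_eq_divide_eq mult.commute)
    then show ?case
      using insert.hyps by (simp add: pochhammer_rec' divide_divide_eq_left mult.commute)
  qed
qed

section \<open>Inversion symmetry of the Weingarten function\<close>

lemma haar_moment_conjugate:
  assumes \<mu>: "haar_unitary n \<mu>" and finI: "finite I"
    and r: "r ` I \<subseteq> {..<n}" and s: "s ` I \<subseteq> {..<n}"
    and jl: "j ` I \<subseteq> {..<n}" "l ` I \<subseteq> {..<n}"
  shows "haar_moment \<mu> I r s j l = haar_moment \<mu> I s r l j"
proof -
  have entry: "map_mat cnj U $$ (x, y) = cnj (U $$ (x, y))"
    if "U \<in> unitary_group n" "x < n" "y < n" for U x y
    using that unitary_group_carrier[OF that(1)] by auto
  have "haar_moment \<mu> I r s j l =
      (\<integral>U. (\<Prod>i\<in>I. map_mat cnj U $$ (r i, j i) * cnj (map_mat cnj U $$ (s i, l i))) \<partial>\<mu>)"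
    unfolding haar_moment_def
    by (rule haar_integral_invariant[OF \<mu> haar_conjugate_invariant[OF \<mu>]
        measurable_map_mat_cnj measurable_moment_integrand[OF \<mu> finI r s jl], symmetric])
  also have "\<dots> = haar_moment \<mu> I s r l j"
    unfolding haar_moment_def
  proof (intro Bochner_Integration.integral_cong refl prod.cong)
    fix U i assume U: "U \<in> space \<mu>" and "i \<in> I"
    then have "r i < n" "s i < n" "j i < n" "l i < n" using r s jl by auto
    then show "map_mat cnj U $$ (r i, j i) * cnj (map_mat cnj U $$ (s i, l i)) =
        U $$ (s i, l i) * cnj (U $$ (r i, j i))"
      using U by (simp add: entry haar_space[OF \<mu>])
  qed
  finally show ?thesis .
qed

lemma Wg_eq_haar_moment:
  "Wg \<mu> k \<pi> = haar_moment \<mu> {1..k} (\<lambda>i. i - 1) (\<lambda>i. i - 1) (\<lambda>i. i - 1) (\<lambda>i. \<pi> i - 1)"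
  by (simp add: Wg_def haar_moment_def prod.distrib)

text \<open>
  Complex conjugation of \<open>U\<close> preserves Haar measure and moves \<open>\<sigma>\<close> from the conjugate to the plain factors;
  relabelling the columns moves its inverse back.
\<close>

lemma Wg_inverse:
  assumes \<mu>: "haar_unitary n \<mu>" and k: "k \<le> n"
    and \<sigma>: "\<sigma> permutes {1..k}" and \<tau>: "\<tau> permutes {1..k}" and inv: "\<And>i. \<sigma> (\<tau> i) = i"
  shows "Wg \<mu> k \<tau> = Wg \<mu> k \<sigma>"
proof -
  let ?e = "\<lambda>i::nat. i - 1"
  have e: "?e ` {1..k} \<subseteq> {..<n}" "inj_on ?e {1..k}" using k by (auto simp: inj_on_def)
  have \<sigma>k: "\<sigma> i \<in> {1..k} \<longleftrightarrow> i \<in> {1..k}" for i by (rule permutes_in_image[OF \<sigma>])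
  have e\<sigma>: "(\<lambda>i. \<sigma> i - 1) ` {1..k} \<subseteq> {..<n}"
  proof (rule image_subsetI)
    fix i assume "i \<in> {1..k}"
    with \<sigma>k[of i] k show "\<sigma> i - 1 \<in> {..<n}" by auto
  qed
  have "{\<tau>'. \<tau>' permutes {1..k} \<and> (\<forall>i\<in>{1..k}. i - 1 = \<sigma> (\<tau>' i) - 1)} = {\<tau>}"
  proof (intro equalityI subsetI)
    fix \<tau>' assume "\<tau>' \<in> {\<tau>'. \<tau>' permutes {1..k} \<and> (\<forall>i\<in>{1..k}. i - 1 = \<sigma> (\<tau>' i) - 1)}"
    then have \<tau>': "\<tau>' permutes {1..k}" and *: "\<And>i. i \<in> {1..k} \<Longrightarrow> i - 1 = \<sigma> (\<tau>' i) - 1" by auto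
    have "\<sigma> (\<tau>' i) = \<sigma> (\<tau> i)" for i
    proof (cases "i \<in> {1..k}")
      case True
      then have "\<sigma> (\<tau>' i) \<in> {1..k}" using \<sigma>k permutes_in_image[OF \<tau>'] by blast
      with *[OF True] True inv[of i] show ?thesis by auto
    next
      case False
      then show ?thesis using permutes_not_in[OF \<tau>' False] permutes_not_in[OF \<tau> False] by simp
    qed
    then have "\<tau>' i = \<tau> i" for i by (simp add: inj_eq[OF permutes_inj[OF \<sigma>]])
    then show "\<tau>' \<in> {\<tau>}" by auto
  qed (use \<tau> inv in auto)
  note P = this
  have "Wg \<mu> k \<sigma> = haar_moment \<mu> {1..k} ?e ?e (\<lambda>i. \<sigma> i - 1) ?e"
    unfolding Wg_eq_haar_moment by (rule haar_moment_conjugate[OF \<mu> _ e(1) e(1) e(1) e\<sigma>]) simp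
  also have "\<dots> = (\<Sum>\<tau>' | \<tau>' permutes {1..k} \<and> (\<forall>i\<in>{1..k}. i - 1 = \<sigma> (\<tau>' i) - 1).
      haar_moment \<mu> {1..k} ?e ?e ?e (?e \<circ> \<tau>'))"
    using k by (intro haar_moment_expansion[OF \<mu> _ e(1) e(1) _ e(2) e(1) e\<sigma> e(1)]) auto
  also have "\<dots> = Wg \<mu> k \<tau>"
    unfolding P by (simp add: Wg_eq_haar_moment comp_def)
  finally show ?thesis ..
qed

section \<open>The recursion\<close>

text \<open>
  Expand the product over the set \<open>T\<close> of factors in which \<open>1\<close> is chosen; \<open>T\<close> must consist of fixed points
  of \<open>g = \<pi> \<circ> \<tau>\<close>. Then \<open>g\<close> permutes the complement of \<open>T\<close> in \<open>{1..n}\<close>, where the last index \<open>n\<close> accounts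
  for the factor outside the product because \<open>\<tau> n = n\<close>. Hence the rest is a product of \<open>n - card T\<close>
  squared moduli from one row.
\<close>

lemma haar_last_row_expectation:
  assumes \<mu>: "haar_unitary n \<mu>" and n: "n \<ge> 2"
    and \<pi>: "\<pi> permutes {1..n}" and \<tau>: "\<tau> permutes {1..n - 1}"
  shows "(\<integral>U. (\<Prod>i=1..n - 1. (if \<pi> (\<tau> i) = i then 1 else 0)
            - U $$ (n - 1, i - 1) * cnj (U $$ (n - 1, \<pi> (\<tau> i) - 1))) *
          (U $$ (n - 1, n - 1) * cnj (U $$ (n - 1, \<pi> n - 1))) \<partial>\<mu>) = wg_coeff n \<pi> \<tau>"
proof -
  define g where "g = \<pi> \<circ> \<tau>"
  define F where "F = {i \<in> {1..n - 1}. g i = i}"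
  let ?I = "{1..n - 1}"
  let ?v = "\<lambda>U i. U $$ (n - 1, i - 1) * cnj (U $$ (n - 1, g i - 1))"
  have g: "g permutes {1..n}"
    unfolding g_def using permutes_subset[OF \<tau>] \<pi> by (intro permutes_compose) auto
  have gn: "g n = \<pi> n" using n by (simp add: g_def permutes_not_in[OF \<tau>])
  have gi: "g i \<in> {1..n} \<longleftrightarrow> i \<in> {1..n}" for i by (rule permutes_in_image[OF g])
  have finF: "finite F" "F \<subseteq> ?I" by (auto simp: F_def)
  have row: "integrable \<mu> (\<lambda>U. \<Prod>i\<in>{1..n} - T. ?v U i) \<and>
      (\<integral>U. (\<Prod>i\<in>{1..n} - T. ?v U i) \<partial>\<mu>) = 1 / pochhammer (of_nat n) (n - card T)"
    if T: "T \<subseteq> F" for T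
  proof -
    let ?R = "{1..n} - T"
    have "T \<subseteq> {1..n}" using T by (auto simp: F_def)
    then have card: "card ?R = n - card T" by (subst card_Diff_subset) (auto intro: finite_subset)
    have g_T: "g i = i" if "i \<in> T" for i using that T by (auto simp: F_def)
    have gR: "g permutes ?R"
      by (rule permutes_superset[OF g]) (use g_T in auto)
    have col: "(\<lambda>i. i - 1) ` ?R \<subseteq> {..<n}" "(\<lambda>i. g i - 1) ` ?R \<subseteq> {..<n}"
    proof -
      show "(\<lambda>i. i - 1) ` ?R \<subseteq> {..<n}" by auto
      show "(\<lambda>i. g i - 1) ` ?R \<subseteq> {..<n}"
      proof (rule image_subsetI)
        fix i assume "i \<in> ?R"
        then have "g i \<in> {1..n}" using gi by blast
        then show "g i - 1 \<in> {..<n}" by auto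
      qed
    qed
    have "integrable \<mu> (\<lambda>U. \<Prod>i\<in>?R. ?v U i)"
      using n by (intro integrable_moment_integrand[OF \<mu>] col) auto
    moreover have "(\<integral>U. (\<Prod>i\<in>?R. ?v U i) \<partial>\<mu>) =
        haar_moment \<mu> ((\<lambda>i. i - 1) ` ?R) (\<lambda>_. n - 1) (\<lambda>_. n - 1) (\<lambda>c. c) (\<lambda>c. c)"
      unfolding haar_moment_def
    proof (intro Bochner_Integration.integral_cong refl)
      fix U :: "complex mat"
      have inj: "inj_on (\<lambda>i::nat. i - 1) ?R" by (auto simp: inj_on_def)
      have "(\<Prod>i\<in>?R. cnj (U $$ (n - 1, g i - 1))) = (\<Prod>i\<in>?R. cnj (U $$ (n - 1, i - 1)))"
        using prod.permute[OF gR, of "\<lambda>i. cnj (U $$ (n - 1, i - 1))"] by (simp only: comp_def)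
      then show "(\<Prod>i\<in>?R. ?v U i) = (\<Prod>c\<in>(\<lambda>i. i - 1) ` ?R. U $$ (n - 1, c) * cnj (U $$ (n - 1, c)))"
        unfolding prod.reindex[OF inj] comp_def by (simp only: prod.distrib)
    qed
    moreover have "card ((\<lambda>i. i - 1) ` ?R) = n - card T"
      unfolding card[symmetric] by (rule card_image) (auto simp: inj_on_def)
    ultimately show ?thesis
      using haar_row_moment[OF \<mu> _ col(1), of "n - 1"] n by simp
  qed
  have expand: "(\<Prod>i\<in>?I. (if g i = i then 1 else 0) - ?v U i) * ?v U n =
      (\<Sum>T\<in>Pow F. (- 1) ^ (n - 1 - card T) * (\<Prod>i\<in>{1..n} - T. ?v U i))" for U
  proof -
    have "(\<Prod>i\<in>?I. (if g i = i then 1 else 0) + (- ?v U i)) =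
        (\<Sum>T\<in>Pow ?I. (\<Prod>i\<in>T. if g i = i then 1 else 0) * (\<Prod>i\<in>?I - T. - ?v U i))"
      by (rule prod_add) simp
    also have "\<dots> = (\<Sum>T\<in>Pow F. \<Prod>i\<in>?I - T. - ?v U i)"
    proof (rule sum.mono_neutral_cong_right)
      show "\<forall>T\<in>Pow ?I - Pow F. (\<Prod>i\<in>T. if g i = i then 1 else 0) * (\<Prod>i\<in>?I - T. - ?v U i) = 0"
      proof
        fix T assume T: "T \<in> Pow ?I - Pow F"
        then obtain i where "i \<in> T" "g i \<noteq> i" by (auto simp: F_def)
        moreover have "finite T" using T by (auto intro: finite_subset)
        ultimately have "(\<Prod>i\<in>T. if g i = i then 1 else 0 :: complex) = 0"
          by (intro prod_zero bexI[of _ i]) auto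
        then show "(\<Prod>i\<in>T. if g i = i then 1 else 0) * (\<Prod>i\<in>?I - T. - ?v U i) = 0" by simp
      qed
      fix T assume "T \<in> Pow F"
      then have "(\<Prod>i\<in>T. if g i = i then 1 else 0 :: complex) = 1"
        by (intro prod.neutral) (auto simp: F_def)
      then show "(\<Prod>i\<in>T. if g i = i then 1 else 0) * (\<Prod>i\<in>?I - T. - ?v U i) = (\<Prod>i\<in>?I - T. - ?v U i)"
        by simp
    qed (use finF in auto)
    finally have "(\<Prod>i\<in>?I. (if g i = i then 1 else 0) - ?v U i) * ?v U n =
        (\<Sum>T\<in>Pow F. (\<Prod>i\<in>?I - T. - ?v U i) * ?v U n)"
      by (simp add: sum_distrib_right)
    also have "\<dots> = (\<Sum>T\<in>Pow F. (- 1) ^ (n - 1 - card T) * (\<Prod>i\<in>{1..n} - T. ?v U i))"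
    proof (rule sum.cong)
      fix T assume "T \<in> Pow F"
      then have T: "T \<subseteq> ?I" "finite T" using finF by (auto intro: finite_subset)
      have "card (?I - T) = n - 1 - card T" using T by (simp add: card_Diff_subset)
      then have "(\<Prod>i\<in>?I - T. - ?v U i) = (- 1) ^ (n - 1 - card T) * (\<Prod>i\<in>?I - T. ?v U i)"
        by (subst prod_uminus) (simp only: mult_ac)
      moreover have R: "{1..n} - T = insert n (?I - T)" using T(1) n by auto
      have "(\<Prod>i\<in>{1..n} - T. ?v U i) = ?v U n * (\<Prod>i\<in>?I - T. ?v U i)"
        unfolding R by (rule prod.insert) (use n in auto)
      ultimately show "(\<Prod>i\<in>?I - T. - ?v U i) * ?v U n =
          (- 1) ^ (n - 1 - card T) * (\<Prod>i\<in>{1..n} - T. ?v U i)"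
        by (simp only: mult_ac)
    qed simp
    finally show ?thesis .
  qed
  have "(\<integral>U. (\<Prod>i\<in>?I. (if g i = i then 1 else 0) - ?v U i) * ?v U n \<partial>\<mu>) =
      (\<Sum>T\<in>Pow F. (- 1) ^ (n - 1 - card T) * (1 / pochhammer (of_nat n) (n - card T)))"
    unfolding expand using row by (subst Bochner_Integration.integral_sum) auto
  also have "\<dots> = (\<Sum>t=0..card F. of_nat (card F choose t) *
      ((- 1) ^ (n - 1 - t) * (1 / pochhammer (of_nat n) (n - t))))"
    by (rule sum_Pow_by_card[OF finF(1)])
  also have "\<dots> = wg_coeff n \<pi> \<tau>"
  proof -
    have F: "fix_count n \<pi> \<tau> = card F" by (simp add: fix_count_def F_def g_def)
    have "card F \<le> n - 1" using card_mono[OF _ finF(2)] by simp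
    then have "(- 1) ^ (n - t + 1) = ((- 1) ^ (n - 1 - t) :: complex)" if "t \<in> {0..card F}" for t
    proof -
      have "n - t + 1 = (n - 1 - t) + 2" using that \<open>card F \<le> n - 1\<close> n by auto
      then show ?thesis by (simp add: power_add)
    qed
    then show ?thesis unfolding wg_coeff_def F by (intro sum.cong) (auto simp: mult_ac)
  qed
  finally show ?thesis by (simp add: gn) (simp add: g_def)
qed

theorem theorem3p10:
  fixes n :: nat and \<pi> :: "nat \<Rightarrow> nat" and \<mu> \<nu> :: "complex mat measure"
  assumes "n \<ge> 2"
    and "haar_unitary n \<mu>"
    and "haar_unitary (n - 1) \<nu>"
    and "\<pi> permutes {1..n}"
  shows "Wg \<mu> n \<pi> = (\<Sum>\<tau> | \<tau> permutes {1..n - 1}. wg_coeff n \<pi> \<tau> * Wg \<nu> (n - 1) \<tau>)"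
proof -
  note \<mu> = assms(2) and \<pi> = assms(4)
  define m where "m = n - 1"
  then have n: "n = Suc m" "m \<ge> 1" using assms(1) by auto
  have \<nu>: "haar_unitary m \<nu>" using assms(3) by (simp add: m_def)
  interpret N: prob_space \<nu> using \<nu> by (simp add: haar_unitary_def)
  let ?I = "{1..m}" and ?e = "\<lambda>i::nat. i - 1"
  let ?J = "?I \<rightarrow>\<^sub>E {..<m}" and ?S = "{\<sigma>. \<sigma> permutes ?I}"
  have finS: "finite ?S" by (rule finite_permutations) simp
  have finJ: "finite ?J" by (rule finite_PiE) auto
  have \<pi>n: "\<pi> i - 1 < n" if "i \<in> {1..n}" for i
    using permutes_in_image[OF \<pi>, of i] that n by auto
  have colI: "?e ` ?I \<subseteq> {..<n}" "(\<lambda>i. \<pi> i - 1) ` ?I \<subseteq> {..<n}" "?e ` ?I \<subseteq> {..<m}"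
    using \<pi>n n by force+
  have J: "j ` ?I \<subseteq> {..<m}" "j ` ?I \<subseteq> {..<n}" if "j \<in> ?J" for j
    using that n by (auto simp: PiE_iff image_subset_iff intro: less_SucI)
  define last where "last U = U $$ (m, m) * cnj (U $$ (m, \<pi> n - 1))" for U :: "complex mat"
  define M where "M j l = (\<integral>U. (\<Prod>i\<in>?I. U $$ (j i, i - 1) * cnj (U $$ (l i, \<pi> i - 1))) * last U \<partial>\<mu>)"
    for j l
  have integrand: "integrable \<mu> (\<lambda>U. (\<Prod>i\<in>?I. U $$ (j i, i - 1) * cnj (U $$ (l i, \<pi> i - 1))) * last U)"
    if jl: "j ` ?I \<subseteq> {..<m}" "l ` ?I \<subseteq> {..<m}" for j l
  proof -
    have "integrable \<mu> (\<lambda>U. \<Prod>i\<in>{1..n}. U $$ ((j(n := m)) i, i - 1) * cnj (U $$ ((l(n := m)) i, \<pi> i - 1)))"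
    proof (rule integrable_moment_integrand[OF \<mu>])
      show "(j(n := m)) ` {1..n} \<subseteq> {..<n}" "(l(n := m)) ` {1..n} \<subseteq> {..<n}"
        using jl n by (force simp: image_subset_iff intro: less_SucI)+
    qed (use \<pi>n in auto)
    moreover have "(\<Prod>i\<in>{1..n}. U $$ ((j(n := m)) i, i - 1) * cnj (U $$ ((l(n := m)) i, \<pi> i - 1)))
      = (\<Prod>i\<in>?I. U $$ (j i, i - 1) * cnj (U $$ (l i, \<pi> i - 1))) * last U" for U
    proof -
      have "(\<Prod>i\<in>?I. U $$ ((j(n := m)) i, i - 1) * cnj (U $$ ((l(n := m)) i, \<pi> i - 1))) =
         (\<Prod>i\<in>?I. U $$ (j i, i - 1) * cnj (U $$ (l i, \<pi> i - 1)))"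
        using n by (intro prod.cong) auto
      then show ?thesis by (simp add: n(1) last_def)
    qed
    ultimately show ?thesis by simp
  qed
  \<comment> \<open>left invariance under \<open>V \<oplus> 1\<close>, for each fixed \<open>V\<close>\<close>
  have expand: "Wg \<mu> n \<pi> = (\<Sum>j\<in>?J. \<Sum>l\<in>?J.
      (\<Prod>i\<in>?I. V $$ (i - 1, j i) * cnj (V $$ (i - 1, l i))) * M j l)"
    if V: "V \<in> unitary_group m" for V
  proof -
    obtain W where W: "W \<in> unitary_group n"
      and upper: "\<And>U i j. U \<in> carrier_mat n n \<Longrightarrow> i < m \<Longrightarrow> j < n \<Longrightarrow>
        (W * U) $$ (i, j) = (\<Sum>p<m. V $$ (i, p) * U $$ (p, j))"
      and lower: "\<And>U j. U \<in> carrier_mat n n \<Longrightarrow> j < n \<Longrightarrow> (W * U) $$ (m, j) = U $$ (m, j)"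
      using unitary_block_embedding[OF V] unfolding n(1)[symmetric] by blast
    let ?f = "\<lambda>U. \<Prod>i\<in>{1..n}. U $$ (i - 1, i - 1) * cnj (U $$ (i - 1, \<pi> i - 1))"
    have f: "?f \<in> borel_measurable (borel_unitary n)"
      using \<pi>n by (intro measurable_moment_integrand[OF \<mu>]) auto
    have "Wg \<mu> n \<pi> = (\<integral>U. ?f U \<partial>\<mu>)" by (simp add: Wg_eq_haar_moment haar_moment_def)
    also have "\<dots> = (\<integral>U. ?f (W * U) \<partial>\<mu>)"
      using \<mu> W by (intro haar_integral_invariant[OF \<mu> _ measurable_unitary_translation[OF W] f, symmetric])
        (simp add: haar_unitary_def)
    also have "\<dots> = (\<integral>U. (\<Sum>j\<in>?J. \<Sum>l\<in>?J. (\<Prod>i\<in>?I. V $$ (i - 1, j i) * cnj (V $$ (i - 1, l i))) *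
        ((\<Prod>i\<in>?I. U $$ (j i, i - 1) * cnj (U $$ (l i, \<pi> i - 1))) * last U)) \<partial>\<mu>)"
    proof (intro Bochner_Integration.integral_cong refl)
      fix U assume "U \<in> space \<mu>"
      then have U: "U \<in> carrier_mat n n" using haar_space[OF \<mu>] unitary_group_carrier by blast
      have "?f (W * U) = (\<Prod>i\<in>?I. (W * U) $$ (i - 1, i - 1) * cnj ((W * U) $$ (i - 1, \<pi> i - 1))) *
          ((W * U) $$ (m, m) * cnj ((W * U) $$ (m, \<pi> n - 1)))"
        by (simp add: n(1))
      also have "(W * U) $$ (m, m) * cnj ((W * U) $$ (m, \<pi> n - 1)) = last U"
        using \<pi>n[of n] n by (simp add: lower[OF U] last_def)
      also have "(\<Prod>i\<in>?I. (W * U) $$ (i - 1, i - 1) * cnj ((W * U) $$ (i - 1, \<pi> i - 1))) =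
        (\<Prod>i\<in>?I. (\<Sum>p<m. V $$ (i - 1, p) * U $$ (p, i - 1)) *
           (\<Sum>p<m. cnj (V $$ (i - 1, p)) * cnj (U $$ (p, \<pi> i - 1))))"
      proof (rule prod.cong)
        fix i assume "i \<in> ?I"
        then have "i - 1 < m" "i - 1 < n" "\<pi> i - 1 < n" using \<pi>n[of i] n by auto
        then show "(W * U) $$ (i - 1, i - 1) * cnj ((W * U) $$ (i - 1, \<pi> i - 1)) =
          (\<Sum>p<m. V $$ (i - 1, p) * U $$ (p, i - 1)) *
           (\<Sum>p<m. cnj (V $$ (i - 1, p)) * cnj (U $$ (p, \<pi> i - 1)))"
          by (simp add: upper[OF U])
      qed simp
      also have "\<dots> = (\<Sum>j\<in>?J. \<Prod>i\<in>?I. V $$ (i - 1, j i) * U $$ (j i, i - 1)) *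
          (\<Sum>l\<in>?J. \<Prod>i\<in>?I. cnj (V $$ (i - 1, l i)) * cnj (U $$ (l i, \<pi> i - 1)))"
        unfolding prod.distrib[of "\<lambda>i. \<Sum>p<m. V $$ (i - 1, p) * U $$ (p, i - 1)"]
        by (subst (1 2) prod_sum_PiE) simp_all
      also have "\<dots> = (\<Sum>j\<in>?J. \<Sum>l\<in>?J. (\<Prod>i\<in>?I. V $$ (i - 1, j i) * U $$ (j i, i - 1)) *
          (\<Prod>i\<in>?I. cnj (V $$ (i - 1, l i)) * cnj (U $$ (l i, \<pi> i - 1))))"
        by (rule sum_product)
      finally show "?f (W * U) = (\<Sum>j\<in>?J. \<Sum>l\<in>?J. (\<Prod>i\<in>?I. V $$ (i - 1, j i) * cnj (V $$ (i - 1, l i))) *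
        ((\<Prod>i\<in>?I. U $$ (j i, i - 1) * cnj (U $$ (l i, \<pi> i - 1))) * last U))"
        unfolding sum_distrib_right prod.distrib
        by (elim trans) (intro sum.cong refl, simp only: mult_ac)
    qed
    also have "\<dots> = (\<Sum>j\<in>?J. \<Sum>l\<in>?J. (\<Prod>i\<in>?I. V $$ (i - 1, j i) * cnj (V $$ (i - 1, l i))) * M j l)"
      unfolding M_def using integrand[OF J(1) J(1)]
      by (simp add: Bochner_Integration.integral_sum Bochner_Integration.integrable_sum)
    finally show ?thesis .
  qed
  have moment: "integrable \<nu> (\<lambda>V. \<Prod>i\<in>?I. V $$ (i - 1, j i) * cnj (V $$ (i - 1, l i)))"
    "(\<integral>V. (\<Prod>i\<in>?I. V $$ (i - 1, j i) * cnj (V $$ (i - 1, l i))) \<partial>\<nu>) =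
      (\<Sum>\<sigma>\<in>?S. if \<forall>i\<in>?I. l i = j (\<sigma> i) then Wg \<nu> m \<sigma> else 0)"
    if j: "j \<in> ?J" and l: "l \<in> ?J" for j l
  proof -
    show "integrable \<nu> (\<lambda>V. \<Prod>i\<in>?I. V $$ (i - 1, j i) * cnj (V $$ (i - 1, l i)))"
      by (rule integrable_moment_integrand[OF \<nu> _ colI(3) colI(3) J(1)[OF j] J(1)[OF l]]) simp
    have "(\<integral>V. (\<Prod>i\<in>?I. V $$ (i - 1, j i) * cnj (V $$ (i - 1, l i))) \<partial>\<nu>) =
        haar_moment \<nu> ?I ?e ?e j l" by (simp add: haar_moment_def)
    also have "\<dots> = (\<Sum>\<sigma> | \<sigma> permutes ?I \<and> (\<forall>i\<in>?I. l i = j (\<sigma> i)). haar_moment \<nu> ?I ?e ?e ?e (?e \<circ> \<sigma>))"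
      by (rule haar_moment_expansion[OF \<nu> _ colI(3) colI(3) _ _ colI(3) J(1)[OF j] J(1)[OF l]])
        (auto simp: inj_on_def)
    also have "\<dots> = (\<Sum>\<sigma> | \<sigma> permutes ?I \<and> (\<forall>i\<in>?I. l i = j (\<sigma> i)). Wg \<nu> m \<sigma>)"
      by (simp only: Wg_eq_haar_moment comp_def)
    also have "\<dots> = (\<Sum>\<sigma>\<in>?S. if \<forall>i\<in>?I. l i = j (\<sigma> i) then Wg \<nu> m \<sigma> else 0)"
      unfolding sum.inter_filter[OF finS, symmetric] by (simp only: mem_Collect_eq)
    finally show "(\<integral>V. (\<Prod>i\<in>?I. V $$ (i - 1, j i) * cnj (V $$ (i - 1, l i))) \<partial>\<nu>) =
      (\<Sum>\<sigma>\<in>?S. if \<forall>i\<in>?I. l i = j (\<sigma> i) then Wg \<nu> m \<sigma> else 0)" .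
  qed
  \<comment> \<open>summing over \<open>j\<close> turns the product into inner products of truncated columns\<close>
  have coeff: "(\<Sum>j\<in>?J. M j (\<lambda>i\<in>?I. j (\<sigma> i))) = wg_coeff n \<pi> \<tau>"
    if \<sigma>: "\<sigma> permutes ?I" and \<tau>: "\<tau> permutes ?I" and inv: "\<And>i. \<sigma> (\<tau> i) = i" for \<sigma> \<tau>
  proof -
    have \<sigma>I: "(\<lambda>i\<in>?I. j (\<sigma> i)) \<in> ?J" if "j \<in> ?J" for j
      using that permutes_in_image[OF \<sigma>] by (auto simp: PiE_iff)
    have "(\<Sum>j\<in>?J. M j (\<lambda>i\<in>?I. j (\<sigma> i))) = (\<integral>U. (\<Sum>j\<in>?J.
        (\<Prod>i\<in>?I. U $$ (j i, i - 1) * cnj (U $$ ((\<lambda>i\<in>?I. j (\<sigma> i)) i, \<pi> i - 1))) * last U) \<partial>\<mu>)"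
      unfolding M_def
      by (rule Bochner_Integration.integral_sum[symmetric]) (intro integrand J(1) \<sigma>I)
    also have "\<dots> = (\<integral>U. (\<Prod>i=1..n - 1. (if \<pi> (\<tau> i) = i then 1 else 0)
            - U $$ (n - 1, i - 1) * cnj (U $$ (n - 1, \<pi> (\<tau> i) - 1))) *
          (U $$ (n - 1, n - 1) * cnj (U $$ (n - 1, \<pi> n - 1))) \<partial>\<mu>)"
    proof (intro Bochner_Integration.integral_cong refl)
      fix U assume "U \<in> space \<mu>"
      then have U: "U \<in> unitary_group n" using haar_space[OF \<mu>] by blast
      have "(\<Prod>i\<in>?I. U $$ (j i, i - 1) * cnj (U $$ ((\<lambda>i\<in>?I. j (\<sigma> i)) i, \<pi> i - 1))) =
          (\<Prod>i\<in>?I. U $$ (j i, i - 1) * cnj (U $$ (j i, \<pi> (\<tau> i) - 1)))" for j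
      proof -
        have "(\<Prod>i\<in>?I. cnj (U $$ (j (\<sigma> i), \<pi> i - 1))) = (\<Prod>i\<in>?I. cnj (U $$ (j i, \<pi> (\<tau> i) - 1)))"
          using prod.permute[OF \<tau>, of "\<lambda>i. cnj (U $$ (j (\<sigma> i), \<pi> i - 1))"]
          by (simp only: comp_def inv)
        then show ?thesis by (simp add: prod.distrib)
      qed
      then have "(\<Sum>j\<in>?J. (\<Prod>i\<in>?I. U $$ (j i, i - 1) * cnj (U $$ ((\<lambda>i\<in>?I. j (\<sigma> i)) i, \<pi> i - 1))) * last U) =
          (\<Sum>j\<in>?J. \<Prod>i\<in>?I. U $$ (j i, i - 1) * cnj (U $$ (j i, \<pi> (\<tau> i) - 1))) * last U"
        by (simp only: sum_distrib_right)
      also have "(\<Sum>j\<in>?J. \<Prod>i\<in>?I. U $$ (j i, i - 1) * cnj (U $$ (j i, \<pi> (\<tau> i) - 1))) =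
          (\<Prod>i\<in>?I. \<Sum>p<m. U $$ (p, i - 1) * cnj (U $$ (p, \<pi> (\<tau> i) - 1)))"
        by (rule prod_sum_PiE[symmetric]) auto
      also have "\<dots> = (\<Prod>i\<in>?I. (if \<pi> (\<tau> i) = i then 1 else 0)
            - U $$ (m, i - 1) * cnj (U $$ (m, \<pi> (\<tau> i) - 1)))"
      proof (rule prod.cong)
        fix i assume i: "i \<in> ?I"
        then have "\<tau> i \<in> {1..n}" using permutes_in_image[OF \<tau>, of i] n by auto
        then have \<pi>\<tau>: "\<pi> (\<tau> i) \<in> {1..n}" using permutes_in_image[OF \<pi>, of "\<tau> i"] by blast
        then have lt: "\<pi> (\<tau> i) - 1 < n" "i - 1 < n" using i n by auto
        have "(\<Sum>p<Suc m. U $$ (p, i - 1) * cnj (U $$ (p, \<pi> (\<tau> i) - 1))) =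
            (if \<pi> (\<tau> i) - 1 = i - 1 then 1 else 0)"
          using unitary_columns_orthonormal[OF U lt] n by (simp add: mult.commute)
        moreover have "\<pi> (\<tau> i) - 1 = i - 1 \<longleftrightarrow> \<pi> (\<tau> i) = i" using i \<pi>\<tau> by auto
        ultimately show "(\<Sum>p<m. U $$ (p, i - 1) * cnj (U $$ (p, \<pi> (\<tau> i) - 1))) =
          (if \<pi> (\<tau> i) = i then 1 else 0) - U $$ (m, i - 1) * cnj (U $$ (m, \<pi> (\<tau> i) - 1))"
          by (simp only: sum.lessThan_Suc eq_diff_eq)
      qed simp
      finally show "(\<Sum>j\<in>?J. (\<Prod>i\<in>?I. U $$ (j i, i - 1) * cnj (U $$ ((\<lambda>i\<in>?I. j (\<sigma> i)) i, \<pi> i - 1))) * last U) =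
         (\<Prod>i=1..n - 1. (if \<pi> (\<tau> i) = i then 1 else 0)
            - U $$ (n - 1, i - 1) * cnj (U $$ (n - 1, \<pi> (\<tau> i) - 1))) *
          (U $$ (n - 1, n - 1) * cnj (U $$ (n - 1, \<pi> n - 1)))"
        unfolding last_def m_def .
    qed
    also have "\<dots> = wg_coeff n \<pi> \<tau>"
      using \<tau> assms(1) by (intro haar_last_row_expectation[OF \<mu> _ \<pi>]) (simp_all add: m_def)
    finally show ?thesis .
  qed
  \<comment> \<open>\<open>expand\<close> has a constant left-hand side, so it can be averaged over \<open>V\<close> term by term, with no
    joint integral over \<open>U\<close> and \<open>V\<close>\<close>
  have "Wg \<mu> n \<pi> = (\<integral>V. Wg \<mu> n \<pi> \<partial>\<nu>)" by (simp add: N.prob_space)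
  also have "\<dots> = (\<integral>V. (\<Sum>j\<in>?J. \<Sum>l\<in>?J.
      (\<Prod>i\<in>?I. V $$ (i - 1, j i) * cnj (V $$ (i - 1, l i))) * M j l) \<partial>\<nu>)"
    by (intro Bochner_Integration.integral_cong refl expand) (simp add: haar_space[OF \<nu>])
  also have "\<dots> = (\<Sum>j\<in>?J. \<Sum>l\<in>?J.
      (\<Sum>\<sigma>\<in>?S. if \<forall>i\<in>?I. l i = j (\<sigma> i) then Wg \<nu> m \<sigma> else 0) * M j l)"
    using moment by (simp add: Bochner_Integration.integral_sum Bochner_Integration.integrable_sum)
  also have "\<dots> = (\<Sum>j\<in>?J. \<Sum>l\<in>?J. \<Sum>\<sigma>\<in>?S. if \<forall>i\<in>?I. l i = j (\<sigma> i) then Wg \<nu> m \<sigma> * M j l else 0)"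
    unfolding sum_distrib_right by (intro sum.cong refl) simp
  also have "\<dots> = (\<Sum>j\<in>?J. \<Sum>\<sigma>\<in>?S. \<Sum>l\<in>?J. if \<forall>i\<in>?I. l i = j (\<sigma> i) then Wg \<nu> m \<sigma> * M j l else 0)"
    by (intro sum.cong refl sum.swap)
  also have "\<dots> = (\<Sum>\<sigma>\<in>?S. \<Sum>j\<in>?J. \<Sum>l\<in>?J. if \<forall>i\<in>?I. l i = j (\<sigma> i) then Wg \<nu> m \<sigma> * M j l else 0)"
    by (rule sum.swap)
  also have "\<dots> = (\<Sum>\<sigma>\<in>?S. \<Sum>j\<in>?J. Wg \<nu> m \<sigma> * M j (\<lambda>i\<in>?I. j (\<sigma> i)))"
  proof (intro sum.cong refl)
    fix \<sigma> j assume "\<sigma> \<in> ?S" and j: "j \<in> ?J"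
    then have \<sigma>: "\<sigma> permutes ?I" by simp
    have "(\<lambda>i\<in>?I. j (\<sigma> i)) \<in> ?J"
      using j permutes_in_image[OF \<sigma>] by (auto simp: PiE_iff)
    moreover have "(\<forall>i\<in>?I. l i = j (\<sigma> i)) \<longleftrightarrow> l = (\<lambda>i\<in>?I. j (\<sigma> i))" if "l \<in> ?J" for l
      using that by (auto simp: PiE_iff extensional_def fun_eq_iff)
    then have "(\<Sum>l\<in>?J. if \<forall>i\<in>?I. l i = j (\<sigma> i) then Wg \<nu> m \<sigma> * M j l else 0) =
      (\<Sum>l\<in>?J. if l = (\<lambda>i\<in>?I. j (\<sigma> i)) then Wg \<nu> m \<sigma> * M j l else 0)"
      by (intro sum.cong refl) (simp only:)
    ultimately show "(\<Sum>l\<in>?J. if \<forall>i\<in>?I. l i = j (\<sigma> i) then Wg \<nu> m \<sigma> * M j l else 0) =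
        Wg \<nu> m \<sigma> * M j (\<lambda>i\<in>?I. j (\<sigma> i))"
      using finJ by simp
  qed
  also have "\<dots> = (\<Sum>\<sigma>\<in>?S. Wg \<nu> m \<sigma> * (\<Sum>j\<in>?J. M j (\<lambda>i\<in>?I. j (\<sigma> i))))"
    by (simp only: sum_distrib_left)
  also have "\<dots> = (\<Sum>\<tau>\<in>?S. Wg \<nu> m (Hilbert_Choice.inv \<tau>) * (\<Sum>j\<in>?J. M j (\<lambda>i\<in>?I. j (Hilbert_Choice.inv \<tau> i))))"
    by (rule sum_permutations_inverse)
  also have "\<dots> = (\<Sum>\<tau>\<in>?S. wg_coeff n \<pi> \<tau> * Wg \<nu> m \<tau>)"
  proof (rule sum.cong)
    fix \<tau> assume "\<tau> \<in> ?S"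
    then have \<tau>: "\<tau> permutes ?I" by simp
    note \<tau>' = permutes_inv[OF \<tau>]
    have "Wg \<nu> m (Hilbert_Choice.inv \<tau>) = Wg \<nu> m \<tau>"
      by (rule Wg_inverse[OF \<nu> _ \<tau> \<tau>']) (simp_all add: permutes_inverses[OF \<tau>])
    moreover have "(\<Sum>j\<in>?J. M j (\<lambda>i\<in>?I. j (Hilbert_Choice.inv \<tau> i))) = wg_coeff n \<pi> \<tau>"
      by (rule coeff[OF \<tau>' \<tau>]) (simp add: permutes_inverses[OF \<tau>])
    ultimately show "Wg \<nu> m (Hilbert_Choice.inv \<tau>) * (\<Sum>j\<in>?J. M j (\<lambda>i\<in>?I. j (Hilbert_Choice.inv \<tau> i))) =
        wg_coeff n \<pi> \<tau> * Wg \<nu> m \<tau>" by simp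
  qed simp
  finally show ?thesis by (simp only: m_def)
qed

end
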